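(* Let $G$ be a connected graph which is not a cycle, every vertex of which has degree at most three, and which has at least one vertex of degree less than three; let $v_1,\dots,v_m$ ($m\ge 1$) be its vertices of degree at most two. Then for any real numbers $x_1,\dots,x_m$ linearly independent over $\mathbb{Q}$, $G$ has a straight-line drawing such that: (1) $v_i$ is mapped to a point with $x$-coordinate $x_i$ for $1\le i\le m$; (2) every edge has slope $0$, $\pi/2$, $\pi/4$ or $-\pi/4$; (3) no vertex lies to the North of any vertex of degree two; (4) no vertex lies to the North or to the Northwest of any vertex of degree one.
   Context: A straight-line drawing maps vertices to distinct points of the plane and edges to segments between the corresponding points that do not pass through any other vertex (crossings allowed). The slope of a line is the angle $\alpha$ mod $\pi$ by which a counterclockwise rotation takes the $x$-axis parallel to it. For points $p_1=(x_1,y_1)$, $p_2=(x_2,y_2)$: $p_2$ is to the North of $p_1$ if $x_2=x_1$ and $y_2>y_1$; $p_2$ is to the Northwest of $p_1$ if $y_2>y_1$ and the line $p_1p_2$ has slope $-\pi/4$ (is parallel to $y=-x$). *)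

theory Defs
  imports "HOL-Analysis.Analysis" "Graph_Theory.Graph_Theory"
begin

text \<open>
  A finite simple graph is a \<open>pair_graph\<close>: each undirected edge is the pair of arcs
  \<open>(u, v)\<close>, \<open>(v, u)\<close>, so the degree of a vertex is its out-degree.
\<close>

abbreviation vdegree :: "'a pair_pre_digraph \<Rightarrow> 'a \<Rightarrow> nat" where
  "vdegree G u \<equiv> out_degree (with_proj G) u"

definition is_cycle_graph :: "'a pair_pre_digraph \<Rightarrow> bool" where
  "is_cycle_graph G \<longleftrightarrow>
     (\<exists>vs. distinct vs \<and> length vs \<ge> 3 \<and> pverts G = set vs \<and>
        parcs G = (\<Union>i<length vs. let a = vs ! i; b = vs ! (Suc i mod length vs)
                                     in {(a, b), (b, a)}))"

text \<open>
  Linear independence over the rationals of the indexed family \<open>(x i)\<close>, \<open>i \<in> I\<close>;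
  \<open>inj_on\<close> is needed because \<open>module.independent\<close> is a property of sets.
\<close>

definition rat_independent_family :: "('i \<Rightarrow> real) \<Rightarrow> 'i set \<Rightarrow> bool" where
  "rat_independent_family x I \<longleftrightarrow>
     inj_on x I \<and> module.independent (\<lambda>(q::rat) (y::real). of_rat q * y) (x ` I)"

text \<open>
  The line through \<open>p\<close> and \<open>q\<close> has slope \<open>\<alpha>\<close> (an angle modulo \<open>pi\<close>): rotating the
  \<open>x\<close>-axis counterclockwise by \<open>\<alpha>\<close> gives the direction \<open>(cos \<alpha>, sin \<alpha>)\<close>, and the line
  is parallel to it.
\<close>

definition has_slope :: "real \<times> real \<Rightarrow> real \<times> real \<Rightarrow> real \<Rightarrow> bool" where
  "has_slope p q \<alpha> \<longleftrightarrow> p \<noteq> q \<and> (\<exists>t::real. q - p = t *\<^sub>R (cos \<alpha>, sin \<alpha>))"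

definition north_of :: "real \<times> real \<Rightarrow> real \<times> real \<Rightarrow> bool" where
  "north_of p2 p1 \<longleftrightarrow> fst p2 = fst p1 \<and> snd p2 > snd p1"

definition northwest_of :: "real \<times> real \<Rightarrow> real \<times> real \<Rightarrow> bool" where
  "northwest_of p2 p1 \<longleftrightarrow> snd p2 > snd p1 \<and> has_slope p1 p2 (- pi / 4)"

definition straight_line_drawing :: "'a pair_pre_digraph \<Rightarrow> ('a \<Rightarrow> real \<times> real) \<Rightarrow> bool" where
  "straight_line_drawing G f \<longleftrightarrow>
     inj_on f (pverts G) \<and>
     (\<forall>(u, v) \<in> parcs G. \<forall>w \<in> pverts G - {u, v}. f w \<notin> closed_segment (f u) (f v))"

end

theory Submission
  imports Defs
begin

text \<open>
  Vertices are removed one at a time and reinserted at the top of the drawing. If \<open>n\<close> is removed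
  from a graph without leaves, a neighbour \<open>c\<close> of degree 3 becomes a vertex of degree 2 whose
  abscissa may be prescribed and to the North of which \<open>n\<close> can be placed arbitrarily high; the
  other neighbour \<open>e\<close> must be joined to \<open>n\<close> diagonally, which is possible if \<open>e\<close> is the topmost
  vertex. So three statements are proved together by induction: there is a drawing; a given leaf
  can be made topmost; a given vertex of degree 2 whose abscissa is not prescribed can be made
  topmost. In the third statement one walks along a path of removed vertices until a vertex of
  degree 2 is met; if both neighbours of \<open>n\<close> have degree 2, then \<open>n\<close> is placed on the horizontal
  through one of them and to the Northwest of the other one, which fixes its abscissa.

  All abscissae are taken from an infinite rationally independent set \<open>B\<close> and free heights are
  multiples of some \<open>h\<close> outside its rational span, which excludes accidental coincidences. Cycles
  are the only obstruction to prescribing all abscissae: in a cyclic component one vertex stays free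
  and its abscissa becomes a rational combination of the others.
\<close>

section \<open>Rational independence\<close>

interpretation rat_real: vector_space "\<lambda>(q::rat) (y::real). of_rat q * y"
  by unfold_locales (auto simp: algebra_simps of_rat_add of_rat_mult)

abbreviation qspan :: "real set \<Rightarrow> real set" where
  "qspan \<equiv> module.span (\<lambda>(q::rat) (y::real). of_rat q * y)"

lemma qspan_multD:
  assumes "real_of_int k * b \<in> qspan A" "k \<noteq> 0" shows "b \<in> qspan A"
proof -
  have "of_rat (1 / of_int k) * (real_of_int k * b) \<in> qspan A"
    using assms(1) by (rule rat_real.span_scale)
  then show ?thesis using assms(2) by (simp add: of_rat_divide)
qed

text \<open>Adjoining one generator enlarges the span by countably many translates, one for each
  rational coefficient.\<close>

lemma countable_qspan_finite: "finite A \<Longrightarrow> countable (qspan A)"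
proof (induction rule: finite_induct)
  case (insert a A)
  have "qspan (insert a A) \<subseteq> (\<lambda>(q::rat, y). of_rat q * a + y) ` (UNIV \<times> qspan A)"
  proof
    fix y assume "y \<in> qspan (insert a A)"
    then obtain q where "y - of_rat q * a \<in> qspan A"
      by (auto simp: rat_real.span_insert)
    then show "y \<in> (\<lambda>(q::rat, y). of_rat q * a + y) ` (UNIV \<times> qspan A)"
      by (intro image_eqI[where x = "(q, y - of_rat q * a)"]) auto
  qed
  then show ?case
    by (rule countable_subset) (simp add: insert)
qed simp

text \<open>A Hamel basis containing \<open>A\<close> is infinite, because a finite set has a
  countable span. One basis element outside \<open>A\<close> is taken out and serves, up to sign, as
  \<open>h\<close>; the rest is \<open>B\<close>.\<close>

lemma infinite_independent_extension:
  assumes "rat_real.independent A" "finite A"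
  obtains B h where "A \<subseteq> B" "infinite B" "\<And>b. b \<in> B \<Longrightarrow> b \<notin> qspan (B - {b})"
    "(h::real) > 0" "h \<notin> qspan B"
proof -
  obtain H where H: "A \<subseteq> H" "rat_real.independent H" "UNIV \<subseteq> qspan H"
    using rat_real.maximal_independent_subset_extend[of A UNIV] assms(1) by auto
  have inf: "infinite H"
    using countable_qspan_finite[of H] H(3) uncountable_UNIV_real
    by (metis countable_subset)
  then obtain g where g: "g \<in> H" "g \<notin> A"
    using assms(2) by (metis finite_subset subsetI)
  have indep: "b \<notin> qspan (H - {b})" if "b \<in> H" for b
    using H(2) that by (auto simp: rat_real.dependent_def)
  have "b \<notin> qspan (H - {g} - {b})" if "b \<in> H - {g}" for b
    using indep[of b] that rat_real.span_mono[of "H - {g} - {b}" "H - {b}"] by auto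
  moreover have "\<bar>g\<bar> \<notin> qspan (H - {g})"
    using indep[OF g(1)] rat_real.span_neg[of "\<bar>g\<bar>" "H - {g}"] by (auto simp: abs_if split: if_splits)
  moreover have "\<bar>g\<bar> > 0"
    using indep[OF g(1)] rat_real.span_zero[of "H - {g}"] by (cases "g = 0") auto
  ultimately show ?thesis
    using that[of "H - {g}" "\<bar>g\<bar>"] inf H(1) g by auto
qed

section \<open>Induced subgraphs\<close>

text \<open>\<open>E\<close> stays fixed while the induction shrinks the vertex set
  \<open>V\<close>, so every graph is an induced subgraph and deletion is set difference.
  \<open>B\<close> is the stock of labels; multiples of \<open>h\<close> are the generic
  heights.\<close>

locale slope_frame =
  fixes E :: "'a \<Rightarrow> 'a \<Rightarrow> bool" and B :: "real set" and h :: real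
  assumes E_sym: "E u w \<Longrightarrow> E w u"
    and E_irrefl: "\<not> E u u"
    and infinite_B: "infinite B"
    and B_indep: "b \<in> B \<Longrightarrow> b \<notin> qspan (B - {b})"
    and h_pos: "h > 0"
    and h_span: "h \<notin> qspan B"
begin

definition nbs :: "'a set \<Rightarrow> 'a \<Rightarrow> 'a set" where
  "nbs V u = {w \<in> V. E u w}"

definition deg :: "'a set \<Rightarrow> 'a \<Rightarrow> nat" where
  "deg V u = card (nbs V u)"

text \<open>Closed sets are the unions of connected components, and cyclic sets those unions whose
  components are cycles. Quantifying over unions avoids paths; minimality is stated explicitly where
  it matters.\<close>

definition closed_in :: "'a set \<Rightarrow> 'a set \<Rightarrow> bool" where
  "closed_in V K \<longleftrightarrow> K \<subseteq> V \<and> (\<forall>u\<in>K. nbs V u \<subseteq> K)"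

definition cyclic_in :: "'a set \<Rightarrow> 'a set \<Rightarrow> bool" where
  "cyclic_in V K \<longleftrightarrow> closed_in V K \<and> (\<forall>u\<in>K. deg V u = 2)"

lemma finite_nbs: "finite V \<Longrightarrow> finite (nbs V u)"
  by (simp add: nbs_def)

lemma nbs_sym: "u \<in> V \<Longrightarrow> w \<in> nbs V u \<Longrightarrow> u \<in> nbs V w"
  by (simp add: nbs_def E_sym)

lemma nbs_irrefl: "u \<notin> nbs V u"
  using E_irrefl by (auto simp: nbs_def)

lemma nbs_remove: "nbs (V - {n}) u = nbs V u - {n}"
  by (auto simp: nbs_def)

lemma deg_remove_nb:
  assumes "finite V" "u \<in> nbs V n" "n \<in> V" shows "deg V u = Suc (deg (V - {n}) u)"
proof -
  have "n \<in> nbs V u" using assms nbs_sym by blast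
  then show ?thesis unfolding deg_def nbs_remove
    using card.remove[OF finite_nbs[OF assms(1)]] by blast
qed

lemma nbs_remove_nonnb: "u \<in> V \<Longrightarrow> u \<notin> nbs V n \<Longrightarrow> nbs (V - {n}) u = nbs V u"
  using E_sym[of u n] by (auto simp: nbs_def)

lemma deg_remove_nonnb: "u \<in> V \<Longrightarrow> u \<notin> nbs V n \<Longrightarrow> deg (V - {n}) u = deg V u"
  by (simp add: deg_def nbs_remove_nonnb)

lemma deg_remove_le: "finite V \<Longrightarrow> deg (V - {n}) u \<le> deg V u"
  unfolding deg_def nbs_remove by (rule card_mono) (auto simp: finite_nbs)

text \<open>Handshake lemma: a new vertex contributes its own degree and raises the degree of each
  of its neighbours by one, twice the same amount.\<close>

lemma even_sum_deg: "finite K \<Longrightarrow> even (\<Sum>u\<in>K. deg K u)"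
proof (induction rule: finite_induct)
  case (insert n K)
  have fin: "finite (insert n K)" using insert by simp
  have rem: "insert n K - {n} = K" using insert by auto
  have n: "nbs (insert n K) n \<subseteq> K" using nbs_irrefl by (fastforce simp: nbs_def)
  have "deg (insert n K) u = deg K u + (if u \<in> nbs (insert n K) n then 1 else 0)" if "u \<in> K" for u
    using deg_remove_nb[OF fin, of u n] deg_remove_nonnb[of u "insert n K" n] that rem by auto
  then have "(\<Sum>u\<in>K. deg (insert n K) u) =
      (\<Sum>u\<in>K. deg K u) + (\<Sum>u\<in>K. if u \<in> nbs (insert n K) n then 1 else 0)"
    by (simp add: sum.distrib)
  also have "(\<Sum>u\<in>K. if u \<in> nbs (insert n K) n then 1 else 0) = deg (insert n K) n"
    using n insert(1) by (simp add: sum.If_cases deg_def Int_absorb1)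
  finally show ?case using insert by simp
qed simp

text \<open>This replaces following a path from one end to the other: a closed piece cannot contain
  just one end, since its degree sum would be odd.\<close>

lemma no_single_odd_vertex:
  assumes "finite Q" "c \<in> Q" "deg Q c = 1" "\<And>u. u \<in> Q \<Longrightarrow> u \<noteq> c \<Longrightarrow> deg Q u = 2"
  shows False
proof -
  have "(\<Sum>u\<in>Q. deg Q u) = deg Q c + (\<Sum>u\<in>Q - {c}. deg Q u)"
    using assms by (simp add: sum.remove)
  also have "(\<Sum>u\<in>Q - {c}. deg Q u) = (\<Sum>u\<in>Q - {c}. 2)"
    using assms by (intro sum.cong) auto
  finally show False
    using even_sum_deg[OF assms(1)] assms(3) by simp
qed

lemma closed_inD: "closed_in V K \<Longrightarrow> u \<in> K \<Longrightarrow> w \<in> nbs V u \<Longrightarrow> w \<in> K"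
  by (auto simp: closed_in_def)

lemma closed_in_deg: "closed_in V K \<Longrightarrow> u \<in> K \<Longrightarrow> deg K u = deg V u"
  unfolding deg_def closed_in_def nbs_def by (rule arg_cong[of _ _ card]) auto

lemma closed_in_remove:
  "closed_in V K \<Longrightarrow> n \<notin> K \<Longrightarrow> closed_in (V - {n}) K"
  by (auto simp: closed_in_def nbs_def)

lemma closed_in_not_nb:
  "closed_in V K \<Longrightarrow> n \<in> V \<Longrightarrow> n \<notin> K \<Longrightarrow> u \<in> K \<Longrightarrow> u \<notin> nbs V n"
  using nbs_sym[of n V u] by (auto simp: closed_in_def)

lemma cyclic_in_remove:
  assumes "cyclic_in V K" "n \<notin> K" "n \<in> V" shows "cyclic_in (V - {n}) K"
proof -
  have K: "closed_in V K" "\<And>u. u \<in> K \<Longrightarrow> deg V u = 2" using assms by (auto simp: cyclic_in_def)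
  have "deg (V - {n}) u = 2" if "u \<in> K" for u
    using K closed_in_not_nb[OF K(1) assms(3,2) that] deg_remove_nonnb[of u V n] that
    by (auto simp: closed_in_def)
  then show ?thesis using K(1) assms(2) by (simp add: cyclic_in_def closed_in_remove)
qed

lemma closed_in_unremove:
  assumes "closed_in (V - {n}) K" "K \<inter> nbs V n = {}" "n \<in> V" shows "closed_in V K"
  unfolding closed_in_def
proof (intro conjI ballI subsetI)
  fix u w assume "u \<in> K" "w \<in> nbs V u"
  moreover from this have "w \<noteq> n"
    using assms(1,2) nbs_sym[of u V n] by (auto simp: closed_in_def)
  ultimately show "w \<in> K" using assms(1) by (auto simp: closed_in_def nbs_remove)
qed (use assms(1) in \<open>auto simp: closed_in_def\<close>)

lemma cyclic_in_unremove:
  assumes "cyclic_in (V - {n}) K" "K \<inter> nbs V n = {}" "n \<in> V" shows "cyclic_in V K"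
proof -
  have "closed_in V K" using closed_in_unremove[of V n K] assms by (simp add: cyclic_in_def)
  moreover have "deg V u = 2" if "u \<in> K" for u
  proof -
    have "u \<in> V" "u \<notin> nbs V n" "deg (V - {n}) u = 2"
      using assms that by (auto simp: cyclic_in_def closed_in_def)
    then show ?thesis using deg_remove_nonnb[of u V n] by simp
  qed
  ultimately show ?thesis by (simp add: cyclic_in_def)
qed

end

section \<open>Extending a drawing by one vertex\<close>

text \<open>The four permitted slopes, free of angles. Coincident points are included; injectivity
  of drawings excludes them separately.\<close>

definition basic_dir :: "real \<times> real \<Rightarrow> real \<times> real \<Rightarrow> bool" where
  "basic_dir p q \<longleftrightarrow> fst q = fst p \<or> \<bar>snd q - snd p\<bar> \<in> {0, \<bar>fst q - fst p\<bar>}"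

definition nw_of :: "real \<times> real \<Rightarrow> real \<times> real \<Rightarrow> bool" where
  "nw_of q p \<longleftrightarrow> snd q > snd p \<and> fst q + snd q = fst p + snd p"

text \<open>The open half-plane below \<open>p\<close> together with the part of its boundary from
  \<open>p\<close> to the right. Breaking ties to the left lets a new vertex on the same horizontal,
  to the left of the highest one, count as the new top.\<close>

definition lex_below :: "real \<times> real \<Rightarrow> (real \<times> real) set" where
  "lex_below p = {q. snd q < snd p \<or> snd q = snd p \<and> fst q \<ge> fst p}"

lemma closed_segmentE_prod:
  fixes p q r :: "real \<times> real"
  assumes "r \<in> closed_segment p q"
  obtains u where "0 \<le> u" "u \<le> 1" "fst r = fst p + u * (fst q - fst p)"
    "snd r = snd p + u * (snd q - snd p)"
proof -
  obtain u where u: "0 \<le> u" "u \<le> 1" "r = (1 - u) *\<^sub>R p + u *\<^sub>R q"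
    using assms by (auto simp: closed_segment_def)
  have "fst r = (1 - u) * fst p + u * fst q" "snd r = (1 - u) * snd p + u * snd q"
    unfolding u(3) by simp_all
  then show ?thesis using u(1,2) by (intro that[of u]) (simp_all add: algebra_simps)
qed

lemma basic_dir_sym: "basic_dir p q \<Longrightarrow> basic_dir q p"
  by (auto simp: basic_dir_def abs_minus_commute)

lemma convex_lex_below: "convex (lex_below p)"
proof (rule convexI)
  fix a b :: "real \<times> real" and s t :: real
  assume ab: "a \<in> lex_below p" "b \<in> lex_below p" and st: "0 \<le> s" "0 \<le> t" "s + t = 1"
  have t: "t = 1 - s" using st by simp
  show "s *\<^sub>R a + t *\<^sub>R b \<in> lex_below p"
  proof (cases "s = 0 \<or> s = 1")
    case True then show ?thesis using ab t by auto
  next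
    case False
    then have s: "0 < s" "s < 1" using st by auto
    \<comment> \<open>If both points are level with \<open>p\<close>, only abscissae matter.
      Otherwise one of them is strictly lower and, as both weights are positive, so is the
      combination.\<close>
    show ?thesis
    proof (cases "snd a = snd p \<and> snd b = snd p")
      case True
      then have "s * fst a + (1 - s) * fst b \<ge> s * fst p + (1 - s) * fst p"
        using ab s by (intro add_mono mult_left_mono) (auto simp: lex_below_def)
      then show ?thesis using True by (simp add: lex_below_def t algebra_simps)
    next
      case False
      have "s * (snd a - snd p) \<le> 0" "(1 - s) * (snd b - snd p) \<le> 0"
        using ab s by (auto simp: lex_below_def mult_le_0_iff)
      moreover have "s * (snd a - snd p) < 0 \<or> (1 - s) * (snd b - snd p) < 0"
        using False ab s by (auto simp: lex_below_def mult_less_0_iff)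
      ultimately have "s * (snd a - snd p) + (1 - s) * (snd b - snd p) < 0" by linarith
      then show ?thesis by (simp add: lex_below_def t algebra_simps)
    qed
  qed
qed

text \<open>Running from \<open>e\<close> to a point outside, the order strictly increases, so the
  set is left at once. Hence an edge from a topmost vertex to a new point outside hits no other
  vertex.\<close>

lemma lex_below_inter_segment:
  assumes "p \<notin> lex_below e" "q \<in> closed_segment e p" "q \<in> lex_below e" shows "q = e"
proof -
  obtain u where u: "0 \<le> u" "u \<le> 1" "fst q = fst e + u * (fst p - fst e)"
    "snd q = snd e + u * (snd p - snd e)"
    using assms(2) by (rule closed_segmentE_prod)
  show ?thesis
  proof (cases "u = 0")
    case True then show ?thesis using u by (simp add: prod_eq_iff)
  next
    case False
    then have u0: "u > 0" using u by simp
    consider "snd p > snd e" | "snd p = snd e" "fst p < fst e"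
      using assms(1) by (fastforce simp: lex_below_def)
    then have False
    proof cases
      case 1 then show False using u u0 assms(3) by (simp add: lex_below_def mult_le_0_iff mult_less_0_iff)
    next
      case 2 then show False using u u0 assms(3) by (simp add: lex_below_def zero_le_mult_iff)
    qed
    then show ?thesis ..
  qed
qed

context slope_frame
begin

section \<open>Invariants of the induction\<close>

definition drawing :: "'a set \<Rightarrow> ('a \<Rightarrow> real \<times> real) \<Rightarrow> bool" where
  "drawing V f \<longleftrightarrow> inj_on f V \<and> (\<forall>u\<in>V. \<forall>w\<in>nbs V u. basic_dir (f u) (f w) \<and>
     (\<forall>z\<in>V - {u, w}. f z \<notin> closed_segment (f u) (f w)))"

definition labelling :: "'a set \<Rightarrow> ('a \<Rightarrow> real) \<Rightarrow> bool" where
  "labelling S x \<longleftrightarrow> inj_on x S \<and> x ` S \<subseteq> B"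

text \<open>\<open>S\<close> is the set of vertices with prescribed abscissa. Every other vertex of degree at most 2 is
  the single free vertex of a cyclic component, unless it belongs to the set \<open>Z\<close> of exceptions.\<close>

definition admissible :: "'a set \<Rightarrow> 'a set \<Rightarrow> 'a set \<Rightarrow> bool" where
  "admissible V S Z \<longleftrightarrow> finite V \<and> S \<subseteq> V \<and> (\<forall>u\<in>V. deg V u \<le> 3) \<and> (\<forall>u\<in>S. deg V u \<le> 2) \<and>
     (\<forall>K. closed_in V K \<longrightarrow> K \<noteq> {} \<longrightarrow> (\<exists>u\<in>K. deg V u \<le> 2)) \<and>
     (\<forall>K. cyclic_in V K \<longrightarrow> K \<noteq> {} \<longrightarrow> \<not> K \<subseteq> S) \<and>
     (\<forall>v\<in>V - S. v \<notin> Z \<longrightarrow> deg V v \<le> 2 \<longrightarrow> (\<exists>K. cyclic_in V K \<and> v \<in> K \<and> K - {v} \<subseteq> S))"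

text \<open>North and Northwest are forbidden for smaller degrees too, since deletions produce
  leaves and isolated vertices. The last clause keeps the abscissa of a free vertex independent of
  all labels outside \<open>K\<close>.\<close>

definition good :: "'a set \<Rightarrow> 'a set \<Rightarrow> ('a \<Rightarrow> real) \<Rightarrow> ('a \<Rightarrow> real \<times> real) \<Rightarrow> bool" where
  "good V S x f \<longleftrightarrow> drawing V f \<and> (\<forall>v\<in>S. fst (f v) = x v) \<and>
     (\<forall>v\<in>V. deg V v \<le> 2 \<longrightarrow> (\<forall>w\<in>V. \<not> north_of (f w) (f v))) \<and>
     (\<forall>v\<in>V. deg V v \<le> 1 \<longrightarrow> (\<forall>w\<in>V. \<not> nw_of (f w) (f v))) \<and>
     (\<forall>v K. cyclic_in V K \<longrightarrow> v \<in> K \<longrightarrow> v \<notin> S \<longrightarrow> K - {v} \<subseteq> S \<longrightarrow>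
        fst (f v) \<in> qspan (x ` (K - {v})))"

definition topmost :: "'a set \<Rightarrow> ('a \<Rightarrow> real \<times> real) \<Rightarrow> 'a \<Rightarrow> bool" where
  "topmost V f z \<longleftrightarrow> z \<in> V \<and> (\<forall>w\<in>V. f w \<in> lex_below (f z))"

text \<open>The third condition keeps vertices that are later placed relative to \<open>z\<close> off the North and
  Northwest rays of the leaves \<open>c\<close>. The hypothesis on \<open>K'\<close> in the last one says that \<open>K\<close> is a
  component, namely a path ending in \<open>z\<close>.\<close>

definition topped :: "'a set \<Rightarrow> 'a set \<Rightarrow> ('a \<Rightarrow> real) \<Rightarrow> 'a \<Rightarrow> ('a \<Rightarrow> real \<times> real) \<Rightarrow> bool" where
  "topped V S x z f \<longleftrightarrow> good V S x f \<and> topmost V f z \<and>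
     (\<forall>c\<in>V - {z}. deg V c \<le> 1 \<longrightarrow> snd (f z) - snd (f c) - x c \<notin> qspan (B - {x c})) \<and>
     (z \<in> S \<longrightarrow> (\<forall>K. closed_in V K \<longrightarrow> z \<in> K \<longrightarrow> K \<subseteq> S \<longrightarrow>
        (\<forall>K'\<subseteq>K. closed_in V K' \<longrightarrow> K' \<noteq> {} \<longrightarrow> z \<in> K') \<longrightarrow>
        (\<forall>w\<in>K. snd (f z) - snd (f w) \<in> qspan (x ` K))))"

text \<open>The convex set \<open>C\<close> separates the old drawing from \<open>p\<close>: old
  edges stay in \<open>C\<close> and cannot meet the new vertex. It remains to check the new edges
  against the old vertices.\<close>

lemma drawing_extend:
  assumes f: "drawing (V - {n}) f" and n: "n \<in> V"
    and C: "convex C" "f ` (V - {n}) \<subseteq> C" "p \<notin> C"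
    and new: "\<And>u. u \<in> nbs V n \<Longrightarrow> basic_dir (f u) p"
      "\<And>u z. u \<in> nbs V n \<Longrightarrow> z \<in> V - {n} \<Longrightarrow> z \<noteq> u \<Longrightarrow> f z \<notin> closed_segment (f u) p"
  shows "drawing V (f(n := p))"
  unfolding drawing_def
proof (intro conjI ballI)
  have "inj_on f (V - {n})" using f by (simp add: drawing_def)
  moreover have "p \<notin> f ` (V - {n})" using C by blast
  ultimately show "inj_on (f(n := p)) V"
    using n by (auto simp: inj_on_def)
next
  fix u w assume uw: "u \<in> V" "w \<in> nbs V u"
  then have wV: "w \<in> V" "u \<noteq> w" using nbs_irrefl by (auto simp: nbs_def)
  show "basic_dir ((f(n := p)) u) ((f(n := p)) w)"
    using uw wV f new(1)[of u] new(1)[of w] nbs_sym[of u V w]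
    by (auto simp: drawing_def nbs_remove intro: basic_dir_sym)
  fix z assume z: "z \<in> V - {u, w}"
  show "(f(n := p)) z \<notin> closed_segment ((f(n := p)) u) ((f(n := p)) w)"
  proof (cases "n \<in> {u, w}")
    case True
    then show ?thesis
      using z uw wV new(2)[of u z] new(2)[of w z] nbs_sym[of u V w]
      by (auto simp: closed_segment_commute)
  next
    case False
    show ?thesis
    proof (cases "z = n")
      case True
      have "closed_segment (f u) (f w) \<subseteq> C"
        using False uw wV C(2) by (intro closed_segment_subset C) auto
      then show ?thesis using True False C(3) by auto
    next
      case zn: False
      have "u \<in> V - {n}" "w \<in> nbs (V - {n}) u" "z \<in> V - {n} - {u, w}"
        using False zn uw z by (auto simp: nbs_remove)
      then show ?thesis using f False zn unfolding drawing_def by auto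
    qed
  qed
qed

lemma goodD:
  assumes "good V S x f"
  shows "drawing V f" "inj_on f V" "\<And>v. v \<in> S \<Longrightarrow> fst (f v) = x v"
    "\<And>v w. v \<in> V \<Longrightarrow> w \<in> V \<Longrightarrow> deg V v \<le> 2 \<Longrightarrow> \<not> north_of (f w) (f v)"
    "\<And>v w. v \<in> V \<Longrightarrow> w \<in> V \<Longrightarrow> deg V v \<le> 1 \<Longrightarrow> \<not> nw_of (f w) (f v)"
    "\<And>v K. cyclic_in V K \<Longrightarrow> v \<in> K \<Longrightarrow> v \<notin> S \<Longrightarrow> K - {v} \<subseteq> S \<Longrightarrow>
        fst (f v) \<in> qspan (x ` (K - {v}))"
  using assms by (auto simp: good_def drawing_def)

lemma admissibleD:
  assumes "admissible V S Z"
  shows "finite V" "S \<subseteq> V" "\<And>u. u \<in> V \<Longrightarrow> deg V u \<le> 3" "\<And>u. u \<in> S \<Longrightarrow> deg V u \<le> 2"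
    "\<And>K. closed_in V K \<Longrightarrow> K \<noteq> {} \<Longrightarrow> \<exists>u\<in>K. deg V u \<le> 2"
    "\<And>K. cyclic_in V K \<Longrightarrow> K \<noteq> {} \<Longrightarrow> \<not> K \<subseteq> S"
    "\<And>v. v \<in> V \<Longrightarrow> v \<notin> S \<Longrightarrow> v \<notin> Z \<Longrightarrow> deg V v \<le> 2 \<Longrightarrow>
      \<exists>K. cyclic_in V K \<and> v \<in> K \<and> K - {v} \<subseteq> S"
  using assms by (auto simp: admissible_def)

text \<open>On a common vertical line one of the two would lie to the North of the other, which is
  forbidden for both.\<close>

lemma good_fst_distinct:
  assumes "good V S x f" "v \<in> V" "w \<in> V" "v \<noteq> w" "deg V v \<le> 2" "deg V w \<le> 2"
  shows "fst (f v) \<noteq> fst (f w)"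
proof
  assume eq: "fst (f v) = fst (f w)"
  have "f v \<noteq> f w" using goodD(2)[OF assms(1)] assms by (auto dest: inj_onD)
  then have "snd (f v) < snd (f w) \<or> snd (f w) < snd (f v)"
    using eq by (auto simp: prod_eq_iff)
  then show False
    using goodD(4)[OF assms(1), of v w] goodD(4)[OF assms(1), of w v] assms eq
    by (auto simp: north_of_def)
qed

lemma north_segment_empty:
  assumes g: "good V S x f" and "c \<in> V" "deg V c \<le> 2" "z \<in> V" "z \<noteq> c"
    and "fst p = fst (f c)" "snd p \<ge> snd (f c)"
  shows "f z \<notin> closed_segment (f c) p"
proof
  assume "f z \<in> closed_segment (f c) p"
  then obtain u where u: "0 \<le> u" "fst (f z) = fst (f c) + u * (fst p - fst (f c))"
    "snd (f z) = snd (f c) + u * (snd p - snd (f c))"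
    by (rule closed_segmentE_prod)
  have "f z \<noteq> f c" using goodD(2)[OF g] assms by (auto dest: inj_onD)
  moreover have "snd (f z) \<ge> snd (f c)" using u assms by simp
  ultimately have "north_of (f z) (f c)" using u assms by (auto simp: north_of_def prod_eq_iff)
  then show False using goodD(4)[OF g] assms by blast
qed

lemma northwest_segment_empty:
  assumes g: "good V S x f" and "c \<in> V" "deg V c \<le> 1" "z \<in> V" "z \<noteq> c"
    and "fst p + snd p = fst (f c) + snd (f c)" "snd p \<ge> snd (f c)"
  shows "f z \<notin> closed_segment (f c) p"
proof
  assume "f z \<in> closed_segment (f c) p"
  then obtain u where u: "0 \<le> u" "fst (f z) = fst (f c) + u * (fst p - fst (f c))"
    "snd (f z) = snd (f c) + u * (snd p - snd (f c))"
    by (rule closed_segmentE_prod)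
  have "f z \<noteq> f c" using goodD(2)[OF g] assms by (auto dest: inj_onD)
  moreover have ge: "snd (f z) \<ge> snd (f c)" using u assms by simp
  moreover have "fst (f z) + snd (f z) = fst (f c) + snd (f c) +
      u * (fst p + snd p - (fst (f c) + snd (f c)))"
    unfolding u(2,3) by algebra
  then have eq: "fst (f z) + snd (f z) = fst (f c) + snd (f c)" using assms by simp
  moreover from this have "snd (f z) \<noteq> snd (f c)" using \<open>f z \<noteq> f c\<close> by (auto simp: prod_eq_iff)
  ultimately have "nw_of (f z) (f c)" by (auto simp: nw_of_def)
  then show False using goodD(5)[OF g] assms by blast
qed

lemma topmost_segment_empty:
  assumes "inj_on f V" "topmost V f e" "p \<notin> lex_below (f e)" "z \<in> V" "z \<noteq> e"
  shows "f z \<notin> closed_segment (f e) p"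
  using lex_below_inter_segment[OF assms(3), of "f z"] assms by (auto simp: topmost_def inj_on_def)

lemma topmost_update:
  assumes "n \<in> V" "\<And>w. w \<in> V - {n} \<Longrightarrow> f w \<in> lex_below p" shows "topmost V (f(n := p)) n"
  using assms by (auto simp: topmost_def lex_below_def)

lemma lex_below_trans: "q \<in> lex_below e \<Longrightarrow> p \<notin> lex_below e \<Longrightarrow> q \<in> lex_below p"
  by (auto simp: lex_below_def)

text \<open>As \<open>n\<close> is topmost, nothing lies above it, so only the rays of old vertices
  have to be kept free of \<open>p\<close>. By \<open>agree\<close>, labels may differ only at
  vertices of degree 3 in \<open>V\<close>, where a neighbour of \<open>n\<close> can carry a
  temporary label.\<close>

lemma good_extend:
  assumes g: "good (V - {n}) S' x' f" and adm: "admissible V S Z" and n: "n \<in> V"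
    and d: "drawing V (f(n := p))" and topmost: "topmost V (f(n := p)) n"
    and agree: "\<And>v. v \<in> V - {n} \<Longrightarrow> deg V v \<le> 2 \<Longrightarrow> (v \<in> S' \<longleftrightarrow> v \<in> S) \<and> x' v = x v"
    and lab: "n \<in> S \<Longrightarrow> fst p = x n"
    and north: "\<And>v. v \<in> V - {n} \<Longrightarrow> deg V v \<le> 2 \<Longrightarrow> fst p \<noteq> fst (f v)"
    and nwest: "\<And>v. v \<in> V - {n} \<Longrightarrow> deg V v \<le> 1 \<Longrightarrow> \<not> nw_of p (f v)"
    and off: "\<And>K v. cyclic_in V K \<Longrightarrow> v \<in> K \<Longrightarrow> v \<notin> S \<Longrightarrow> K - {v} \<subseteq> S \<Longrightarrow> v \<noteq> n \<Longrightarrow> n \<notin> K"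
    and cyc: "\<And>K. cyclic_in V K \<Longrightarrow> n \<in> K \<Longrightarrow> n \<notin> S \<Longrightarrow> K - {n} \<subseteq> S \<Longrightarrow>
        fst p \<in> qspan (x ` (K - {n}))"
  shows "good V S x (f(n := p))"
proof -
  note fin = admissibleD(1)[OF adm]
  have maxn: "snd (f w) \<le> snd p" if "w \<in> V - {n}" for w
    using topmost that by (auto simp: topmost_def lex_below_def split: if_splits)
  have 1: "fst ((f(n := p)) v) = x v" if "v \<in> S" for v
    using that lab agree[of v] admissibleD(2,4)[OF adm] goodD(3)[OF g, of v] by auto
  have 2: "\<not> north_of ((f(n := p)) w) ((f(n := p)) v)" if "v \<in> V" "deg V v \<le> 2" "w \<in> V" for v w
  proof -
    have "\<not> north_of (f w) (f v)" if "v \<noteq> n" "w \<noteq> n"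
      using goodD(4)[OF g, of v w] deg_remove_le[OF fin, of n v] that \<open>v \<in> V\<close> \<open>w \<in> V\<close> \<open>deg V v \<le> 2\<close>
      by auto
    then show ?thesis using north[of v] maxn[of w] that by (auto simp: north_of_def)
  qed
  have 3: "\<not> nw_of ((f(n := p)) w) ((f(n := p)) v)" if "v \<in> V" "deg V v \<le> 1" "w \<in> V" for v w
  proof -
    have "\<not> nw_of (f w) (f v)" if "v \<noteq> n" "w \<noteq> n"
      using goodD(5)[OF g, of v w] deg_remove_le[OF fin, of n v] that \<open>v \<in> V\<close> \<open>w \<in> V\<close> \<open>deg V v \<le> 1\<close>
      by auto
    then show ?thesis using nwest[of v] maxn[of w] that by (auto simp: nw_of_def)
  qed
  \<comment> \<open>A cyclic set whose free vertex is not \<open>n\<close> avoids \<open>n\<close>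
    by \<open>off\<close>, so it was already cyclic before the insertion.\<close>
  have 4: "fst ((f(n := p)) v) \<in> qspan (x ` (K - {v}))"
    if K: "cyclic_in V K" "v \<in> K" "v \<notin> S" "K - {v} \<subseteq> S" for v K
  proof (cases "v = n")
    case True then show ?thesis using cyc K by simp
  next
    case False
    have nK: "n \<notin> K" using off K False by blast
    have KV: "\<And>u. u \<in> K \<Longrightarrow> u \<in> V - {n} \<and> deg V u \<le> 2"
      using K(1) nK by (auto simp: cyclic_in_def closed_in_def)
    have "v \<notin> S'" "K - {v} \<subseteq> S'" using K agree KV by blast+
    then have "fst (f v) \<in> qspan (x' ` (K - {v}))"
      using goodD(6)[OF g cyclic_in_remove[OF K(1) nK n]] K by blast
    moreover have "x' ` (K - {v}) = x ` (K - {v})" using agree KV by (auto intro!: image_cong)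
    ultimately show ?thesis using False by simp
  qed
  show ?thesis unfolding good_def using d 1 2 3 4 by blast
qed

text \<open>Degrees change only at the neighbours of \<open>n\<close>, which end with degree at most
  2. A closed set avoiding them was closed before, so \<open>nocyc\<close> and \<open>free\<close>
  concern only the neighbours, while \<open>off\<close> keeps the old cycles with a free vertex
  intact.\<close>

lemma admissible_remove:
  assumes adm: "admissible V S Z" and n: "n \<in> V"
    and S': "S' \<subseteq> V - {n}" "S' \<subseteq> S \<union> nbs V n"
    and agree: "\<And>v. v \<in> V - {n} \<Longrightarrow> deg V v \<le> 2 \<Longrightarrow> v \<in> S' \<longleftrightarrow> v \<in> S"
    and nocyc: "\<And>K. cyclic_in (V - {n}) K \<Longrightarrow> K \<inter> nbs V n \<noteq> {} \<Longrightarrow> \<not> K \<subseteq> S'"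
    and free: "\<And>v. v \<in> nbs V n \<Longrightarrow> v \<notin> S' \<Longrightarrow> v \<notin> Z' \<Longrightarrow>
        \<exists>K. cyclic_in (V - {n}) K \<and> v \<in> K \<and> K - {v} \<subseteq> S'"
    and Z: "Z - {n} \<subseteq> Z'"
    and off: "\<And>K v. cyclic_in V K \<Longrightarrow> v \<in> K \<Longrightarrow> v \<notin> S \<Longrightarrow> K - {v} \<subseteq> S \<Longrightarrow> v \<noteq> n \<Longrightarrow> n \<notin> K"
  shows "admissible (V - {n}) S' Z'"
proof -
  note a = admissibleD[OF adm]
  have le: "deg (V - {n}) u \<le> deg V u" for u using deg_remove_le[OF a(1)] .
  have drop: "deg (V - {n}) u \<le> 2" if "u \<in> nbs V n" for u
    using deg_remove_nb[OF a(1) that n] a(3)[of u] that by (auto simp: nbs_def)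
  have 1: "deg (V - {n}) u \<le> 2" if "u \<in> S'" for u
    using that S'(2) drop[of u] le[of u] a(4)[of u] by fastforce
  have 2: "\<exists>u\<in>K. deg (V - {n}) u \<le> 2" if K: "closed_in (V - {n}) K" "K \<noteq> {}" for K
  proof (cases "K \<inter> nbs V n = {}")
    case True
    then obtain u where "u \<in> K" "deg V u \<le> 2" using a(5) closed_in_unremove[OF K(1) True n] K(2) by blast
    then show ?thesis using le[of u] by (intro bexI[of _ u]) auto
  next
    case False then show ?thesis using drop by blast
  qed
  have 3: "\<not> K \<subseteq> S'" if K: "cyclic_in (V - {n}) K" "K \<noteq> {}" for K
  proof (cases "K \<inter> nbs V n = {}")
    case True
    have KV: "cyclic_in V K" by (rule cyclic_in_unremove[OF K(1) True n])
    then have "\<And>u. u \<in> K \<Longrightarrow> deg V u \<le> 2 \<and> u \<in> V - {n}"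
      using K by (auto simp: cyclic_in_def closed_in_def)
    then show ?thesis using a(6)[OF KV K(2)] agree by blast
  next
    case False then show ?thesis using nocyc K by blast
  qed
  have 4: "\<exists>K. cyclic_in (V - {n}) K \<and> v \<in> K \<and> K - {v} \<subseteq> S'"
    if v: "v \<in> V - {n} - S'" "v \<notin> Z'" "deg (V - {n}) v \<le> 2" for v
  proof (cases "v \<in> nbs V n")
    case True then show ?thesis using free v by blast
  next
    case False
    then have dv: "deg V v \<le> 2" using v deg_remove_nonnb[of v V n] by auto
    then have vS: "v \<notin> S" "v \<notin> Z" using agree[of v] v Z by auto
    then obtain K where K: "cyclic_in V K" "v \<in> K" "K - {v} \<subseteq> S" using a(7)[of v] v dv by auto
    have nK: "n \<notin> K" using off[OF K(1,2) vS(1) K(3)] v by auto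
    have "\<And>u. u \<in> K \<Longrightarrow> deg V u \<le> 2 \<and> u \<in> V - {n}"
      using K(1) nK by (auto simp: cyclic_in_def closed_in_def)
    then have "K - {v} \<subseteq> S'" using K(3) agree by blast
    then show ?thesis using cyclic_in_remove[OF K(1) nK n] K by blast
  qed
  have 5: "deg (V - {n}) u \<le> 3" if "u \<in> V - {n}" for u
    using le[of u] a(3)[of u] that by auto
  show ?thesis unfolding admissible_def using a(1) S'(1) 1 2 3 4 5 by auto
qed

section \<open>Generic labels and heights\<close>

lemma qspan_mono: "A \<subseteq> A' \<Longrightarrow> qspan A \<subseteq> qspan A'"
  by (rule rat_real.span_mono)

lemma label_span:
  assumes "labelling S x" "A \<subseteq> S" "c \<in> S" "c \<notin> A" shows "qspan (x ` A) \<subseteq> qspan (B - {x c})"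
proof (rule qspan_mono)
  show "x ` A \<subseteq> B - {x c}" using assms unfolding labelling_def inj_on_def by blast
qed

lemma label_in_span:
  assumes "labelling S x" "y \<in> S" "c \<in> S" "y \<noteq> c" shows "x y \<in> qspan (B - {x c})"
  using label_span[OF assms(1), of "{y}" c] assms rat_real.span_base[of "x y" "{x y}"] by auto

lemma label_notin_span: "labelling S x \<Longrightarrow> c \<in> S \<Longrightarrow> x c \<notin> qspan (B - {x c})"
  using B_indep by (auto simp: labelling_def)

text \<open>For each \<open>c\<close> at most one multiple of \<open>h\<close> is bad, as the
  difference of two bad ones would put \<open>h\<close> into the span of \<open>B\<close>. Only
  finitely many natural multiples are too low.\<close>

lemma generic_height:
  assumes "finite V"
  obtains Y where "\<And>w. w \<in> V \<Longrightarrow> snd (f w) < Y"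
    "\<And>c. c \<in> V \<Longrightarrow> Y - snd (f c) - (x c :: real) \<notin> qspan (B - {x c})"
proof -
  define bad where "bad c = {k::nat. k * h - snd (f c) - x c \<in> qspan (B - {x c})}" for c
  have "finite (bad c)" for c
  proof (cases "bad c = {}")
    case False
    then obtain k where k: "k \<in> bad c" by blast
    have "k' = k" if "k' \<in> bad c" for k'
    proof (rule ccontr)
      assume ne: "k' \<noteq> k"
      have "(k' * h - snd (f c) - x c) - (k * h - snd (f c) - x c) \<in> qspan (B - {x c})"
        using k that rat_real.span_diff unfolding bad_def by blast
      then have "real_of_int (int k' - int k) * h \<in> qspan (B - {x c})"
        by (simp add: algebra_simps)
      then have "h \<in> qspan (B - {x c})" by (rule qspan_multD) (use ne in simp)
      then show False using h_span qspan_mono[of "B - {x c}" B] by blast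
    qed
    then have "bad c \<subseteq> {k}" by blast
    then show ?thesis by (rule finite_subset) simp
  qed simp
  moreover have "finite {k::nat. k * h \<le> snd (f w)}" for w
  proof -
    have "{k::nat. k * h \<le> snd (f w)} \<subseteq> {..nat \<lceil>snd (f w) / h\<rceil>}"
    proof
      fix k :: nat assume "k \<in> {k. k * h \<le> snd (f w)}"
      then have "real k \<le> snd (f w) / h" using h_pos by (simp add: pos_le_divide_eq)
      then show "k \<in> {..nat \<lceil>snd (f w) / h\<rceil>}" by simp linarith
    qed
    then show ?thesis by (rule finite_subset) simp
  qed
  ultimately have "finite (\<Union>w\<in>V. bad w \<union> {k::nat. k * h \<le> snd (f w)})" using assms by blast
  then obtain k where "k \<notin> (\<Union>w\<in>V. bad w \<union> {k::nat. k * h \<le> snd (f w)})"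
    using infinite_UNIV_nat ex_new_if_finite by blast
  then show ?thesis by (intro that[of "k * h"]) (auto simp: bad_def)
qed

text \<open>To the Northwest of \<open>q\<close> one has \<open>snd p - snd q - b = - fst p\<close>.
  This explains the expression in the third clause of \<open>topped\<close>.\<close>

lemma not_nw_of_generic:
  assumes "snd p - snd q - b \<notin> qspan (B - {b})" "fst q = b" "fst p \<in> qspan (B - {b})"
  shows "\<not> nw_of p q"
proof
  assume "nw_of p q"
  then have "snd p - snd q - b = - fst p" using assms(2) by (auto simp: nw_of_def)
  then show False using assms(1,3) rat_real.span_neg by metis
qed

section \<open>Positions for the reinserted vertex\<close>

lemma place_high:
  assumes g: "good (V - {n}) S x f" and n: "n \<in> V" and nb: "nbs V n \<subseteq> {a}"
    and a: "a \<in> nbs V n \<Longrightarrow> deg (V - {n}) a \<le> 2 \<and> fst p = fst (f a)"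
    and high: "\<And>w. w \<in> V - {n} \<Longrightarrow> snd (f w) < snd p"
  shows "drawing V (f(n := p))" "topmost V (f(n := p)) n"
proof -
  have aV: "a \<in> V - {n}" if "a \<in> nbs V n" using that nbs_irrefl by (auto simp: nbs_def)
  show "drawing V (f(n := p))"
  proof (rule drawing_extend[OF goodD(1)[OF g] n, of "{q. snd q < snd p}"])
    have "{q::real\<times>real. snd q < snd p} = UNIV \<times> {..<snd p}" by auto
    then show "convex {q::real\<times>real. snd q < snd p}" by (simp add: convex_Times)
  next
    fix u assume "u \<in> nbs V n"
    then show "basic_dir (f u) p" using a nb by (auto simp: basic_dir_def)
  next
    fix u z assume u: "u \<in> nbs V n" and z: "z \<in> V - {n}" "z \<noteq> u"
    then have "u = a" using nb by blast
    then show "f z \<notin> closed_segment (f u) p"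
      using north_segment_empty[OF g, of a z p] a aV high[of a] u z by simp
  qed (use high in auto)
  show "topmost V (f(n := p)) n" using high by (intro topmost_update[OF n]) (auto simp: lex_below_def)
qed

lemma place_beside:
  assumes g: "good (V - {n}) S x f" and n: "n \<in> V" and nb: "nbs V n = {a}"
    and t: "topmost (V - {n}) f a" and p: "p \<notin> lex_below (f a)" "basic_dir (f a) p"
  shows "drawing V (f(n := p))" "topmost V (f(n := p)) n"
proof -
  show "drawing V (f(n := p))"
  proof (rule drawing_extend[OF goodD(1)[OF g] n convex_lex_below[of "f a"]])
    fix u z assume u: "u \<in> nbs V n" and z: "z \<in> V - {n}" "z \<noteq> u"
    then show "f z \<notin> closed_segment (f u) p"
      using topmost_segment_empty[OF goodD(2)[OF g] t p(1)] nb by simp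
  qed (use t p nb in \<open>auto simp: topmost_def\<close>)
  show "topmost V (f(n := p)) n"
    using t lex_below_trans[OF _ p(1)] by (intro topmost_update[OF n]) (auto simp: topmost_def)
qed

lemma place_above_two:
  assumes g: "good (V - {n}) S x f" and n: "n \<in> V" and nb: "nbs V n = {c, e}"
    and deg: "deg (V - {n}) c \<le> 2" and t: "topmost (V - {n}) f e"
    and ne: "fst (f c) \<noteq> fst (f e)"
    and p: "p = (fst (f c), snd (f e) + \<bar>fst (f c) - fst (f e)\<bar>)"
  shows "drawing V (f(n := p))" "topmost V (f(n := p)) n"
proof -
  have ce: "c \<in> V - {n}" "e \<in> V - {n}" using nb nbs_irrefl[of n V] by (auto simp: nbs_def)
  \<comment> \<open>The height exceeds that of \<open>e\<close> by the horizontal distance, which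
    makes the edge to \<open>e\<close> diagonal; by \<open>ne\<close> the excess is
    positive.\<close>
  have pe: "p \<notin> lex_below (f e)" using ne p by (auto simp: lex_below_def)
  have "f c \<in> lex_below (f e)" using t ce(1) by (simp add: topmost_def)
  then have "snd (f c) \<le> snd (f e)" by (auto simp: lex_below_def)
  then have pc: "snd (f c) \<le> snd p" using p by simp
  show "drawing V (f(n := p))"
  proof (rule drawing_extend[OF goodD(1)[OF g] n convex_lex_below[of "f e"]])
    fix u assume "u \<in> nbs V n"
    then show "basic_dir (f u) p" using nb p by (auto simp: basic_dir_def)
  next
    fix u z assume u: "u \<in> nbs V n" and z: "z \<in> V - {n}" "z \<noteq> u"
    then show "f z \<notin> closed_segment (f u) p"
      using topmost_segment_empty[OF goodD(2)[OF g] t pe, of z] nb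
        north_segment_empty[OF g ce(1) deg, of z p] pc p by auto
  qed (use t pe in \<open>auto simp: topmost_def\<close>)
  show "topmost V (f(n := p)) n"
    using t lex_below_trans[OF _ pe] by (intro topmost_update[OF n]) (auto simp: topmost_def)
qed

lemma place_left_two:
  assumes g: "good (V - {n}) S x f" and n: "n \<in> V" and nb: "nbs V n = {c, e}"
    and deg: "deg (V - {n}) c \<le> 1" and t: "topmost (V - {n}) f e"
    and lt: "fst (f c) < fst (f e)"
    and p: "p = (fst (f c) - (snd (f e) - snd (f c)), snd (f e))"
  shows "drawing V (f(n := p))" "topmost V (f(n := p)) n" "snd (f c) < snd (f e)"
proof -
  have ce: "c \<in> V - {n}" "e \<in> V - {n}" using nb nbs_irrefl[of n V] by (auto simp: nbs_def)
  \<comment> \<open>A vertex level with the topmost \<open>e\<close> cannot lie to its left, as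
    \<open>c\<close> does.\<close>
  show pc: "snd (f c) < snd (f e)" using t ce lt by (auto simp: topmost_def lex_below_def)
  \<comment> \<open>\<open>p\<close> is level with \<open>e\<close> and to its left, being even to
    the left of \<open>c\<close>; by the tie-breaking it is outside.\<close>
  have pe: "p \<notin> lex_below (f e)" using pc lt p by (auto simp: lex_below_def)
  show "drawing V (f(n := p))"
  proof (rule drawing_extend[OF goodD(1)[OF g] n convex_lex_below[of "f e"]])
    fix u assume "u \<in> nbs V n"
    then show "basic_dir (f u) p" using nb p pc by (auto simp: basic_dir_def)
  next
    fix u z assume u: "u \<in> nbs V n" and z: "z \<in> V - {n}" "z \<noteq> u"
    then show "f z \<notin> closed_segment (f u) p"
      using topmost_segment_empty[OF goodD(2)[OF g] t pe, of z] nb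
        northwest_segment_empty[OF g ce(1) deg, of z p] pc p by auto
  qed (use t pe in \<open>auto simp: topmost_def\<close>)
  show "topmost V (f(n := p)) n"
    using t lex_below_trans[OF _ pe] by (intro topmost_update[OF n]) (auto simp: topmost_def)
qed

section \<open>Making a leaf topmost\<close>

definition drawable :: "'a set \<Rightarrow> bool" where
  "drawable V \<longleftrightarrow> (\<forall>S x. admissible V S {} \<longrightarrow> labelling S x \<longrightarrow> (\<exists>f. good V S x f))"

definition leaf_toppable :: "'a set \<Rightarrow> bool" where
  "leaf_toppable V \<longleftrightarrow> (\<forall>S x z. admissible V S {} \<longrightarrow> labelling S x \<longrightarrow> z \<in> S \<longrightarrow> deg V z \<le> 1 \<longrightarrow>
     (\<exists>f. topped V S x z f))"

text \<open>The disjunction ensures that both neighbours of \<open>z\<close> have degree 2 or 3. Its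
  first case arises when a cubic vertex loses a neighbour in a leafless graph, its second when
  \<open>z\<close> is the free vertex of a cycle.\<close>

definition free_toppable :: "'a set \<Rightarrow> bool" where
  "free_toppable V \<longleftrightarrow> (\<forall>S x z. admissible V S {z} \<longrightarrow> labelling S x \<longrightarrow> z \<in> V - S \<longrightarrow> deg V z = 2 \<longrightarrow>
     (\<forall>u\<in>V. 2 \<le> deg V u) \<or> (\<exists>K. cyclic_in V K \<and> z \<in> K \<and> K - {z} \<subseteq> S) \<longrightarrow>
     (\<exists>f. topped V S x z f))"

lemma leaf_notin_cyclic: "deg V l \<le> 1 \<Longrightarrow> cyclic_in V K \<Longrightarrow> l \<notin> K"
  by (auto simp: cyclic_in_def)

lemma leaf_prescribed:
  assumes "admissible V S Z" "v \<in> V" "v \<notin> Z" "deg V v \<le> 1" shows "v \<in> S"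
  using admissibleD(7)[OF assms(1), of v] assms leaf_notin_cyclic by fastforce

text \<open>A prescribed \<open>v\<close> has a different label. A free one has its abscissa in the
  span of the labels on its cycle, to which the leaf \<open>l\<close> does not belong.\<close>

lemma leaf_fst_distinct:
  assumes adm: "admissible V S {}" and lab: "labelling S x" and l: "l \<in> S" "deg V l \<le> 1"
    and g: "good (V - {l}) S' x' f" and v: "v \<in> V - {l}" "deg V v \<le> 2"
    and agree: "\<And>v. v \<in> V - {l} \<Longrightarrow> deg V v \<le> 2 \<Longrightarrow> (v \<in> S' \<longleftrightarrow> v \<in> S) \<and> x' v = x v"
  shows "x l \<noteq> fst (f v)"
proof (cases "v \<in> S")
  case True
  then have "fst (f v) = x v" using goodD(3)[OF g] agree[OF v] by simp
  then show ?thesis using True lab l v by (auto simp: labelling_def inj_on_def)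
next
  case False
  then obtain K where K: "cyclic_in V K" "v \<in> K" "K - {v} \<subseteq> S"
    using admissibleD(7)[OF adm, of v] v by auto
  have lK: "l \<notin> K" using leaf_notin_cyclic[OF l(2) K(1)] .
  have KV: "u \<in> V - {l} \<and> deg V u \<le> 2" if "u \<in> K" for u
    using K(1) lK that by (auto simp: cyclic_in_def closed_in_def)
  have lV: "l \<in> V" using admissibleD(2)[OF adm] l by blast
  have "v \<notin> S'" "K - {v} \<subseteq> S'" using K False agree KV by blast+
  then have "fst (f v) \<in> qspan (x' ` (K - {v}))"
    using goodD(6)[OF g cyclic_in_remove[OF K(1) lK lV]] K by blast
  moreover have "x' ` (K - {v}) = x ` (K - {v})" using agree KV by (auto intro!: image_cong)
  moreover have "qspan (x ` (K - {v})) \<subseteq> qspan (B - {x l})"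
    using K(3) lK by (intro label_span[OF lab _ l(1)]) auto
  ultimately show ?thesis using label_notin_span[OF lab l(1)] by auto
qed

lemma leaf_toppable_isolated:
  assumes dr: "drawable (V - {l})" and adm: "admissible V S {}" and lab: "labelling S x"
    and l: "l \<in> S" "nbs V l = {}"
  shows "\<exists>f. topped V S x l f"
proof -
  have dl: "deg V l \<le> 1" using l by (simp add: deg_def)
  have lV: "l \<in> V" using admissibleD(2)[OF adm] l by blast
  have "admissible (V - {l}) (S - {l}) {}"
    using admissibleD(2)[OF adm] l leaf_notin_cyclic[OF dl]
    by (intro admissible_remove[OF adm lV]) auto
  moreover have "labelling (S - {l}) x" using lab by (auto simp: labelling_def inj_on_def)
  ultimately obtain f where g: "good (V - {l}) (S - {l}) x f" using dr by (auto simp: drawable_def)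
  obtain Y where Y: "\<And>w. w \<in> V - {l} \<Longrightarrow> snd (f w) < Y"
    "\<And>c. c \<in> V - {l} \<Longrightarrow> Y - snd (f c) - x c \<notin> qspan (B - {x c})"
    using generic_height[of "V - {l}" f x] admissibleD(1)[OF adm] by blast
  let ?p = "(x l, Y)"
  have d: "drawing V (f(l := ?p))" and t: "topmost V (f(l := ?p)) l"
    using place_high[OF g lV, of l ?p] l(2) Y(1) by auto
  have "good V S x (f(l := ?p))"
  proof (rule good_extend[OF g adm lV d t])
    fix v assume v: "v \<in> V - {l}" "deg V v \<le> 2"
    show "fst ?p \<noteq> fst (f v)" using leaf_fst_distinct[OF adm lab l(1) dl g v] by auto
  next
    fix v assume v: "v \<in> V - {l}" "deg V v \<le> 1"
    then have vS: "v \<in> S" using leaf_prescribed[OF adm] by auto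
    show "\<not> nw_of ?p (f v)"
      using not_nw_of_generic[of ?p "f v" "x v"] Y(2)[OF v(1)] goodD(3)[OF g, of v] v vS
        label_in_span[OF lab l(1) vS] by auto
  qed (use l leaf_notin_cyclic[OF dl] in auto)
  moreover have "\<forall>w\<in>K. snd ((f(l := ?p)) l) - snd ((f(l := ?p)) w) \<in> qspan (x ` K)"
    if K: "closed_in V K" "l \<in> K" "\<forall>K'\<subseteq>K. closed_in V K' \<longrightarrow> K' \<noteq> {} \<longrightarrow> l \<in> K'" for K
  proof -
    \<comment> \<open>The rest of \<open>K\<close> is closed as well, so minimality leaves only the
      isolated vertex itself.\<close>
    have "closed_in V (K - {l})"
      using K(1) l(2) nbs_sym[of _ V l] by (fastforce simp: closed_in_def)
    then have "K - {l} = {}" using K(3) by blast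
    then show ?thesis using rat_real.span_zero by auto
  qed
  ultimately show ?thesis using t Y(2) by (auto simp: topped_def intro!: exI[of _ "f(l := ?p)"])
qed

text \<open>Without \<open>l\<close> the vertex \<open>a\<close> has degree 2 and can borrow the
  label of \<open>l\<close>, so that \<open>l\<close> goes vertically above it. By
  \<open>nocyc\<close> this creates no fully prescribed cycle.\<close>

lemma leaf_toppable_cubic:
  assumes dr: "drawable (V - {l})" and adm: "admissible V S {}" and lab: "labelling S x"
    and l: "l \<in> S" "nbs V l = {a}" and a: "deg V a = 3"
    and nocyc: "\<And>K. cyclic_in (V - {l}) K \<Longrightarrow> a \<in> K \<Longrightarrow> \<not> K - {a} \<subseteq> S"
  shows "\<exists>f. topped V S x l f"
proof -
  have dl: "deg V l \<le> 1" using l by (simp add: deg_def)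
  have lV: "l \<in> V" using admissibleD(2)[OF adm] l by blast
  have aV: "a \<in> V - {l}" using l(2) nbs_irrefl[of l V] by (auto simp: nbs_def)
  have da: "deg (V - {l}) a = 2"
    using deg_remove_nb[OF admissibleD(1)[OF adm], of a l] l(2) lV a by auto
  have aS: "a \<notin> S" using a admissibleD(4)[OF adm, of a] by auto
  let ?S = "insert a (S - {l})" and ?x = "x(a := x l)"
  have agree: "(v \<in> ?S \<longleftrightarrow> v \<in> S) \<and> ?x v = x v" if "v \<in> V - {l}" "deg V v \<le> 2" for v
    using that a by auto
  have "admissible (V - {l}) ?S {}"
  proof (rule admissible_remove[OF adm lV])
    fix K assume "cyclic_in (V - {l}) K" "K \<inter> nbs V l \<noteq> {}"
    then show "\<not> K \<subseteq> ?S" using nocyc[of K] l(2) by auto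
  qed (use admissibleD(2)[OF adm] l aV agree leaf_notin_cyclic[OF dl] in auto)
  moreover have "labelling ?S ?x" using lab l aS by (auto simp: labelling_def inj_on_def)
  ultimately obtain f where g: "good (V - {l}) ?S ?x f" using dr by (auto simp: drawable_def)
  obtain Y where Y: "\<And>w. w \<in> V - {l} \<Longrightarrow> snd (f w) < Y"
    "\<And>c. c \<in> V - {l} \<Longrightarrow> Y - snd (f c) - x c \<notin> qspan (B - {x c})"
    using generic_height[of "V - {l}" f x] admissibleD(1)[OF adm] by blast
  let ?p = "(x l, Y)"
  have fa: "fst (f a) = x l" using goodD(3)[OF g, of a] by simp
  have d: "drawing V (f(l := ?p))" and t: "topmost V (f(l := ?p)) l"
    using place_high[OF g lV, of a ?p] l(2) da fa Y(1) by auto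
  have "good V S x (f(l := ?p))"
  proof (rule good_extend[OF g adm lV d t agree])
    fix v assume v: "v \<in> V - {l}" "deg V v \<le> 2"
    show "fst ?p \<noteq> fst (f v)" using leaf_fst_distinct[OF adm lab l(1) dl g v agree] by auto
  next
    fix v assume v: "v \<in> V - {l}" "deg V v \<le> 1"
    then have vS: "v \<in> S" using leaf_prescribed[OF adm] by auto
    show "\<not> nw_of ?p (f v)"
      using not_nw_of_generic[of ?p "f v" "x v"] Y(2)[OF v(1)] goodD(3)[OF g, of v] v vS aS
        label_in_span[OF lab l(1) vS] by (cases "v = a") auto
  qed (use l leaf_notin_cyclic[OF dl] in auto)
  \<comment> \<open>For the last clause of \<open>topped\<close>: a closed set with \<open>l\<close>
    contains \<open>a\<close>, which has degree 3 and so is not in \<open>S\<close>.\<close>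
  moreover have "\<not> (closed_in V K \<and> l \<in> K \<and> K \<subseteq> S)" for K
    using l(2) aS closed_inD[of V K l a] by auto
  ultimately show ?thesis using t Y(2) by (auto simp: topped_def intro!: exI[of _ "f(l := ?p)"])
qed

text \<open>Here borrowing the label would overdetermine \<open>K0\<close>. Instead \<open>a\<close>
  stays free and is made topmost; its abscissa is a combination of the labels on \<open>K0\<close>,
  hence differs from \<open>x l\<close>, and \<open>l\<close> is joined to it diagonally.\<close>

lemma leaf_toppable_pendant_cycle:
  assumes ft: "free_toppable (V - {l})" and adm: "admissible V S {}" and lab: "labelling S x"
    and l: "l \<in> S" "nbs V l = {a}" and a: "deg V a = 3"
    and K0: "cyclic_in (V - {l}) K0" "a \<in> K0" "K0 - {a} \<subseteq> S"
  shows "\<exists>f. topped V S x l f"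
proof -
  have dl: "deg V l \<le> 1" using l by (simp add: deg_def)
  have lV: "l \<in> V" using admissibleD(2)[OF adm] l by blast
  have aV: "a \<in> V - {l}" using l(2) nbs_irrefl[of l V] by (auto simp: nbs_def)
  have da: "deg (V - {l}) a = 2"
    using deg_remove_nb[OF admissibleD(1)[OF adm], of a l] l(2) lV a by auto
  have aS: "a \<notin> S" using a admissibleD(4)[OF adm, of a] by auto
  have K0': "K0 - {a} \<subseteq> S - {l}" using K0 by (auto simp: cyclic_in_def closed_in_def)
  have agree: "(v \<in> S - {l} \<longleftrightarrow> v \<in> S) \<and> x v = x v" if "v \<in> V - {l}" "deg V v \<le> 2" for v
    using that by auto
  have "admissible (V - {l}) (S - {l}) {a}"
    using admissibleD(2)[OF adm] l aV aS leaf_notin_cyclic[OF dl]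
    by (intro admissible_remove[OF adm lV]) auto
  moreover have "labelling (S - {l}) x" using lab by (auto simp: labelling_def inj_on_def)
  ultimately obtain f where f: "topped (V - {l}) (S - {l}) x a f"
    using ft K0 K0' da aV aS unfolding free_toppable_def by blast
  then have g: "good (V - {l}) (S - {l}) x f" and ta: "topmost (V - {l}) f a"
    and off: "\<And>c. c \<in> V - {l} - {a} \<Longrightarrow> deg (V - {l}) c \<le> 1 \<Longrightarrow>
        snd (f a) - snd (f c) - x c \<notin> qspan (B - {x c})"
    by (auto simp: topped_def)
  have fa: "fst (f a) \<in> qspan (x ` (K0 - {a}))"
    using goodD(6)[OF g K0(1,2) _ K0'] aS by blast
  have fa_span: "fst (f a) \<in> qspan (B - {x c})" if "c \<in> S" "c \<notin> K0" for c
    using fa label_span[OF lab K0(3) that(1)] that by blast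
  have lK0: "l \<notin> K0" using K0 by (auto simp: cyclic_in_def closed_in_def)
  have ne: "x l \<noteq> fst (f a)" using fa_span[OF l(1) lK0] label_notin_span[OF lab l(1)] by auto
  define p where "p = (x l, snd (f a) + \<bar>x l - fst (f a)\<bar>)"
  have d: "drawing V (f(l := p))" and t: "topmost V (f(l := p)) l"
    using place_beside[OF g lV l(2) ta, of p] ne by (auto simp: p_def lex_below_def basic_dir_def)
  \<comment> \<open>Passing from \<open>a\<close> to \<open>l\<close> raises the top by an element
    of the span of the labels other than \<open>x c\<close>, so genericity is inherited.\<close>
  have offl: "snd p - snd (f c) - x c \<notin> qspan (B - {x c})" if c: "c \<in> V - {l}" "deg V c \<le> 1" for c
  proof
    assume *: "snd p - snd (f c) - x c \<in> qspan (B - {x c})"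
    have ca: "c \<noteq> a" "c \<in> S" using c a leaf_prescribed[OF adm] by auto
    have dc: "deg (V - {l}) c \<le> 1" using c deg_remove_le[OF admissibleD(1)[OF adm], of l c] by simp
    then have "c \<notin> K0" using leaf_notin_cyclic[OF _ K0(1)] by blast
    then have "x l - fst (f a) \<in> qspan (B - {x c})"
      using fa_span ca label_in_span[OF lab l(1)] c by (auto intro: rat_real.span_diff)
    then have "\<bar>x l - fst (f a)\<bar> \<in> qspan (B - {x c})"
      using rat_real.span_neg by (fastforce simp: abs_if)
    from rat_real.span_diff[OF * this] have "snd (f a) - snd (f c) - x c \<in> qspan (B - {x c})"
      by (simp add: p_def algebra_simps)
    then show False using off[of c] c ca dc by auto
  qed
  have "good V S x (f(l := p))"
  proof (rule good_extend[OF g adm lV d t agree])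
    fix v assume v: "v \<in> V - {l}" "deg V v \<le> 2"
    show "fst p \<noteq> fst (f v)"
      using leaf_fst_distinct[OF adm lab l(1) dl g v agree] by (auto simp: p_def)
  next
    fix v assume v: "v \<in> V - {l}" "deg V v \<le> 1"
    then have vS: "v \<in> S" using leaf_prescribed[OF adm] by auto
    show "\<not> nw_of p (f v)"
      using not_nw_of_generic[of p "f v" "x v"] offl[OF v] goodD(3)[OF g, of v] v vS
        label_in_span[OF lab l(1) vS] by (auto simp: p_def)
  qed (use l leaf_notin_cyclic[OF dl] in \<open>auto simp: p_def\<close>)
  moreover have "\<not> (closed_in V K \<and> l \<in> K \<and> K \<subseteq> S)" for K
    using l(2) aS closed_inD[of V K l a] by auto
  ultimately show ?thesis using t offl by (auto simp: topped_def intro!: exI[of _ "f(l := p)"])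
qed

text \<open>Deleting \<open>l\<close> turns \<open>a\<close> into a prescribed vertex of degree at
  most 1, to which the same statement applies; repetition walks along the path.\<close>

lemma leaf_toppable_path:
  assumes lt: "leaf_toppable (V - {l})" and adm: "admissible V S {}" and lab: "labelling S x"
    and l: "l \<in> S" "nbs V l = {a}" and a: "deg V a \<le> 2"
  shows "\<exists>f. topped V S x l f"
proof -
  have dl: "deg V l \<le> 1" using l by (simp add: deg_def)
  have lV: "l \<in> V" using admissibleD(2)[OF adm] l by blast
  have aV: "a \<in> V - {l}" using l(2) nbs_irrefl[of l V] by (auto simp: nbs_def)
  have ap: "a \<in> nbs V l" using l by simp
  have da: "deg (V - {l}) a \<le> 1"
    using deg_remove_nb[OF admissibleD(1)[OF adm] ap lV] a by auto
  have aS: "a \<in> S"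
  proof (rule ccontr)
    assume "a \<notin> S"
    then obtain K where "cyclic_in V K" "a \<in> K" using admissibleD(7)[OF adm, of a] a aV by auto
    then show False
      using leaf_notin_cyclic[OF dl] closed_inD[of V K a l] nbs_sym[OF lV ap]
      by (auto simp: cyclic_in_def)
  qed
  have agree: "(v \<in> S - {l} \<longleftrightarrow> v \<in> S) \<and> x v = x v" if "v \<in> V - {l}" "deg V v \<le> 2" for v
    using that by auto
  have "admissible (V - {l}) (S - {l}) {}"
  proof (rule admissible_remove[OF adm lV])
    fix K assume K: "cyclic_in (V - {l}) K" "K \<inter> nbs V l \<noteq> {}"
    then show "\<not> K \<subseteq> S - {l}" using l(2) leaf_notin_cyclic[OF da K(1)] by auto
  qed (use admissibleD(2)[OF adm] l aV aS leaf_notin_cyclic[OF dl] in auto)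
  moreover have "labelling (S - {l}) x" using lab by (auto simp: labelling_def inj_on_def)
  ultimately obtain f where f: "topped (V - {l}) (S - {l}) x a f"
    using lt da aV aS unfolding leaf_toppable_def by blast
  then have g: "good (V - {l}) (S - {l}) x f" and ta: "topmost (V - {l}) f a"
    and off: "\<And>c. c \<in> V - {l} - {a} \<Longrightarrow> deg (V - {l}) c \<le> 1 \<Longrightarrow>
        snd (f a) - snd (f c) - x c \<notin> qspan (B - {x c})"
    by (auto simp: topped_def)
  have rig: "snd (f a) - snd (f w) \<in> qspan (x ` K)"
    if "closed_in (V - {l}) K" "a \<in> K" "K \<subseteq> S - {l}" "w \<in> K"
      "\<And>K'. K' \<subseteq> K \<Longrightarrow> closed_in (V - {l}) K' \<Longrightarrow> K' \<noteq> {} \<Longrightarrow> a \<in> K'" for K w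
    using f that unfolding topped_def by blast
  have fa: "fst (f a) = x a" using goodD(3)[OF g, of a] aS aV by auto
  have ne: "x l \<noteq> x a" using lab l aS aV by (auto simp: labelling_def inj_on_def)
  \<comment> \<open>A diagonal going up is safe if \<open>a\<close> has degree 2 or \<open>l\<close>
    lies to its right. If \<open>a\<close> is a leaf and \<open>l\<close> lies to its left, it would
    put \<open>l\<close> to the Northwest of \<open>a\<close>; the edge is then horizontal, which
    the tie-breaking to the left allows.\<close>
  define y where "y = (if deg V a = 2 \<or> x a < x l then \<bar>x l - x a\<bar> else 0)"
  define p where "p = (x l, snd (f a) + y)"
  have p: "p \<notin> lex_below (f a)" "basic_dir (f a) p"
    using ne by (auto simp: p_def y_def lex_below_def basic_dir_def fa)
  have d: "drawing V (f(l := p))" and t: "topmost V (f(l := p)) l"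
    using place_beside[OF g lV l(2) ta p] by auto
  have y_span: "y \<in> qspan A" if "x l \<in> qspan A" "x a \<in> qspan A" for A
    using rat_real.span_diff[OF that] rat_real.span_diff[OF that(2,1)] rat_real.span_zero[of A]
    by (auto simp: y_def abs_if)
  have offl: "snd p - snd (f c) - x c \<notin> qspan (B - {x c})" if c: "c \<in> V - {l}" "deg V c \<le> 1" for c
  proof
    assume *: "snd p - snd (f c) - x c \<in> qspan (B - {x c})"
    have cS: "c \<in> S" using c leaf_prescribed[OF adm] by auto
    have xl: "x l \<in> qspan (B - {x c})" using label_in_span[OF lab l(1) cS] c by auto
    show False
    proof (cases "c = a")
      case False
      have dc: "deg (V - {l}) c \<le> 1" using c deg_remove_le[OF admissibleD(1)[OF adm], of l c] by simp
      have "y \<in> qspan (B - {x c})" using y_span[OF xl label_in_span[OF lab aS cS]] False by auto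
      from rat_real.span_diff[OF * this] have "snd (f a) - snd (f c) - x c \<in> qspan (B - {x c})"
        by (simp add: p_def algebra_simps)
      then show False using off[of c] c False dc by auto
    next
      \<comment> \<open>Here \<open>a\<close> is a leaf of \<open>V\<close>, and the number in
        question is \<open>x l - 2 * x a\<close> or \<open>- x a\<close>, depending on the side of
        \<open>l\<close>.\<close>
      case True
      show False
      proof (cases "x a < x l")
        case gt: True
        then have "x l - (snd p - snd (f c) - x c) = real_of_int 2 * x a"
          using True by (simp add: p_def y_def)
        then have "real_of_int 2 * x a \<in> qspan (B - {x c})" using rat_real.span_diff[OF xl *] by simp
        then have "x a \<in> qspan (B - {x a})" using qspan_multD[of 2 "x a"] True by simp
        then show False using label_notin_span[OF lab aS] by simp
      next
        case le: False
        then have "- (snd p - snd (f c) - x c) = x a" using True c by (simp add: p_def y_def)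
        then show False using rat_real.span_neg[OF *] label_notin_span[OF lab aS] True by simp
      qed
    qed
  qed
  have "good V S x (f(l := p))"
  proof (rule good_extend[OF g adm lV d t agree])
    fix v assume v: "v \<in> V - {l}" "deg V v \<le> 2"
    show "fst p \<noteq> fst (f v)"
      using leaf_fst_distinct[OF adm lab l(1) dl g v agree] by (auto simp: p_def)
  next
    fix v assume v: "v \<in> V - {l}" "deg V v \<le> 1"
    then have vS: "v \<in> S" using leaf_prescribed[OF adm] by auto
    show "\<not> nw_of p (f v)"
      using not_nw_of_generic[of p "f v" "x v"] offl[OF v] goodD(3)[OF g, of v] v vS
        label_in_span[OF lab l(1) vS] by (auto simp: p_def)
  qed (use l leaf_notin_cyclic[OF dl] in \<open>auto simp: p_def\<close>)
  moreover have "snd ((f(l := p)) l) - snd ((f(l := p)) w) \<in> qspan (x ` K)"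
    if K: "closed_in V K" "l \<in> K" "K \<subseteq> S"
      "\<forall>K'\<subseteq>K. closed_in V K' \<longrightarrow> K' \<noteq> {} \<longrightarrow> l \<in> K'" and w: "w \<in> K" for K w
  proof (cases "w = l")
    case True then show ?thesis using rat_real.span_zero by simp
  next
    case False
    have aK: "a \<in> K" using closed_inD[OF K(1,2)] l(2) by simp
    \<comment> \<open>\<open>K - {l}\<close> is the component of \<open>a\<close> after the
      deletion, so its height differences are known; \<open>y\<close> then adds a combination of
      \<open>x l\<close> and \<open>x a\<close>.\<close>
    have "snd (f a) - snd (f w) \<in> qspan (x ` (K - {l}))"
    proof (rule rig)
      show "closed_in (V - {l}) (K - {l})" using K(1) by (auto simp: closed_in_def nbs_remove)
      fix K' assume K': "K' \<subseteq> K - {l}" "closed_in (V - {l}) K'" "K' \<noteq> {}"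
      show "a \<in> K'"
      proof (rule ccontr)
        assume "a \<notin> K'"
        then have "closed_in V K'" using closed_in_unremove[OF K'(2) _ lV] l(2) by auto
        then show False using K(4) K' by blast
      qed
    qed (use K aK aV w False in auto)
    then have "snd (f a) - snd (f w) \<in> qspan (x ` K)" using qspan_mono[of "x ` (K - {l})" "x ` K"] by blast
    moreover have "y \<in> qspan (x ` K)" using K(2) aK by (intro y_span rat_real.span_base imageI)
    ultimately have "snd (f a) - snd (f w) + y \<in> qspan (x ` K)" by (rule rat_real.span_add)
    then show ?thesis using False by (simp add: p_def algebra_simps)
  qed
  ultimately show ?thesis using t offl by (auto simp: topped_def intro!: exI[of _ "f(l := p)"])
qed

lemma leaf_toppable_step:
  assumes IH: "\<And>n. n \<in> V \<Longrightarrow> drawable (V - {n}) \<and> leaf_toppable (V - {n}) \<and> free_toppable (V - {n})"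
  shows "leaf_toppable V"
  unfolding leaf_toppable_def
proof (intro allI impI)
  fix S x l assume adm: "admissible V S {}" and lab: "labelling S x" and l: "l \<in> S" "deg V l \<le> 1"
  have lV: "l \<in> V" using admissibleD(2)[OF adm] l by blast
  note ih = IH[OF lV]
  show "\<exists>f. topped V S x l f"
  proof (cases "nbs V l = {}")
    case True then show ?thesis using leaf_toppable_isolated[OF _ adm lab l(1)] ih by blast
  next
    case False
    then have "card (nbs V l) = 1"
      using l(2) finite_nbs[OF admissibleD(1)[OF adm], of l] card_gt_0_iff[of "nbs V l"]
      by (simp add: deg_def)
    then obtain a where a: "nbs V l = {a}" by (auto simp: card_1_singleton_iff)
    then have aV: "a \<in> V" by (auto simp: nbs_def)
    then consider "deg V a \<le> 2" | "deg V a = 3" using admissibleD(3)[OF adm, of a] by linarith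
    then show ?thesis
    proof cases
      case 1 then show ?thesis using leaf_toppable_path[OF _ adm lab l(1) a] ih by blast
    next
      \<comment> \<open>The two lemmas divide according to whether \<open>a\<close> lies on a cycle
        that is prescribed except at \<open>a\<close>.\<close>
      case 2 then show ?thesis
        using leaf_toppable_cubic[OF _ adm lab l(1) a] leaf_toppable_pendant_cycle[OF _ adm lab l(1) a] ih
        by blast
    qed
  qed
qed

section \<open>Leafless graphs and free vertices\<close>

text \<open>If the cycle through \<open>a\<close> obstructs the removal of \<open>t\<close>, then a neighbour \<open>t'\<close> of \<open>a\<close> on
  that cycle can be removed instead, by parity.\<close>

lemma obtain_removable:
  assumes adm: "admissible V S {}" and ne: "V \<noteq> {}" and two: "\<And>u. u \<in> V \<Longrightarrow> 2 \<le> deg V u"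
    and S: "\<And>u. u \<in> V \<Longrightarrow> deg V u \<le> 2 \<Longrightarrow> u \<in> S"
  obtains t a where "t \<in> S" "a \<in> nbs V t" "deg V a = 3"
    "\<And>K. cyclic_in (V - {t}) K \<Longrightarrow> a \<in> K \<Longrightarrow> \<not> K - {a} \<subseteq> S"
proof -
  note a = admissibleD[OF adm]
  have deg2: "deg V u = 2" if "u \<in> S" for u using two[of u] a(2,4) that by force
  \<comment> \<open>\<open>S\<close> is nonempty and consists of vertices of degree 2. If it were
    closed, it would be a forbidden fully prescribed cyclic set, so some edge leaves it.\<close>
  have "\<not> cyclic_in V S" if "S \<noteq> {}" using a(6)[of S] that by auto
  moreover have "S \<noteq> {}" using a(5)[of V] ne S by (auto simp: closed_in_def nbs_def)
  ultimately have "\<not> closed_in V S" using deg2 by (auto simp: cyclic_in_def)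
  then obtain t a where ta: "t \<in> S" "a \<in> nbs V t" "a \<notin> S" using a(2) by (auto simp: closed_in_def)
  then have aV: "a \<in> V" and tV: "t \<in> V" using a(2) by (auto simp: nbs_def)
  have a3: "deg V a = 3" using S[OF aV] ta(3) a(3)[OF aV] by fastforce
  show ?thesis
  proof (cases "\<exists>K. cyclic_in (V - {t}) K \<and> a \<in> K \<and> K - {a} \<subseteq> S")
    case False then show ?thesis using that ta a3 by blast
  next
    case True
    then obtain K where K: "cyclic_in (V - {t}) K" "a \<in> K" "K - {a} \<subseteq> S" by blast
    have clK: "closed_in (V - {t}) K" and KV: "K \<subseteq> V - {t}" using K by (auto simp: cyclic_in_def closed_in_def)
    \<comment> \<open>\<open>u\<close> has degree 2 both with and without \<open>t\<close>.\<close>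
    have nt: "u \<notin> nbs V t" if "u \<in> K - {a}" for u
    proof
      assume "u \<in> nbs V t"
      then have "deg V u = Suc (deg (V - {t}) u)" using deg_remove_nb[OF a(1) _ tV] by blast
      then show False using deg2[of u] K that by (auto simp: cyclic_in_def)
    qed
    have "card (nbs (V - {t}) a) = 2" using K by (auto simp: cyclic_in_def deg_def)
    then obtain t' where t': "t' \<in> nbs (V - {t}) a" by fastforce
    have t'K: "t' \<in> K" using closed_inD[OF clK K(2) t'] .
    have t'a: "t' \<noteq> a" using t' nbs_irrefl by blast
    have t'S: "t' \<in> S" and t'V: "t' \<in> V" using K t'K t'a KV by auto
    have at': "a \<in> nbs V t'" using t' nbs_sym[OF aV, of t'] by (auto simp: nbs_remove)
    obtain b where b: "nbs V t' = {a, b}" "b \<noteq> a"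
    proof -
      have "card (nbs V t' - {a}) = 1"
        using deg2[OF t'S] at' finite_nbs[OF a(1)] by (simp add: deg_def)
      then obtain b where "nbs V t' - {a} = {b}" by (auto simp: card_1_singleton_iff)
      then show ?thesis using at' by (intro that[of b]) auto
    qed
    have "t \<notin> nbs V t'" using nt[of t'] t'K t'a nbs_sym[OF t'V, of t] by blast
    then have "b \<in> nbs (V - {t}) t'" using b by (auto simp: nbs_remove)
    then have bK: "b \<in> K" using closed_inD[OF clK t'K] by blast
    have bt': "b \<noteq> t'" using b nbs_irrefl by blast
    show ?thesis
    proof (rule that[OF t'S at' a3])
      fix K' assume K': "cyclic_in (V - {t'}) K'" "a \<in> K'"
      have clK': "closed_in (V - {t'}) K'" using K' by (auto simp: cyclic_in_def)
      show "\<not> K' - {a} \<subseteq> S"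
      proof
        assume K'S: "K' - {a} \<subseteq> S"
        \<comment> \<open>\<open>Q\<close> is what the supposed cyclic set \<open>K'\<close> through
          \<open>a\<close> leaves of \<open>K - {t'}\<close>. In it only \<open>b\<close>, which
          lost the neighbour \<open>t'\<close>, has odd degree.\<close>
        define Q where "Q = K - {t'} - K'"
        have bV: "b \<in> V - {t'}" using bK bt' KV by auto
        have "deg V b = Suc (deg (V - {t'}) b)" using deg_remove_nb[OF a(1) _ t'V] b by blast
        moreover have "deg V b = 2" using deg2 K bK b by blast
        ultimately have "b \<notin> K'" using K' by (auto simp: cyclic_in_def)
        then have bQ: "b \<in> Q" using bK bt' by (simp add: Q_def)
        have nbQ: "nbs Q u = nbs V u - {t'}" if u: "u \<in> Q" for u
        proof
          show "nbs Q u \<subseteq> nbs V u - {t'}" using KV by (auto simp: nbs_def Q_def)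
          show "nbs V u - {t'} \<subseteq> nbs Q u"
          proof
            fix w assume w: "w \<in> nbs V u - {t'}"
            have uK: "u \<in> K - {a}" "u \<in> V" using u K' KV by (auto simp: Q_def)
            have "w \<noteq> t" using nt[OF uK(1)] nbs_sym[OF uK(2), of w] w by auto
            then have wK: "w \<in> K" using closed_inD[OF clK, of u w] uK w by (auto simp: nbs_remove)
            have "w \<notin> K'"
            proof
              assume "w \<in> K'"
              then have "u \<in> K'"
                using closed_inD[OF clK', of w u] nbs_sym[OF uK(2), of w] w u by (auto simp: nbs_remove Q_def)
              then show False using u by (simp add: Q_def)
            qed
            then show "w \<in> nbs Q u" using w wK by (auto simp: nbs_def Q_def)
          qed
        qed
        have degQ: "deg Q u = 2" if u: "u \<in> Q" "u \<noteq> b" for u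
        proof -
          have "u \<notin> nbs V t'" using b u K' by (auto simp: Q_def)
          then have "t' \<notin> nbs V u" using nbs_sym[of u V t'] u KV by (auto simp: Q_def)
          then have "nbs Q u = nbs V u" using nbQ[OF u(1)] by blast
          moreover have "deg V u = 2" using deg2[of u] K u K' by (auto simp: Q_def)
          ultimately show ?thesis by (simp add: deg_def)
        qed
        have "deg Q b = 1"
          using nbQ[OF bQ] \<open>deg V b = Suc (deg (V - {t'}) b)\<close> \<open>deg V b = 2\<close>
          by (simp add: deg_def nbs_remove)
        moreover have "finite Q" using a(1) KV by (auto simp: Q_def intro: finite_subset)
        ultimately show False using no_single_odd_vertex[OF _ bQ _ degQ] by blast
      qed
    qed
  qed
qed

text \<open>Here \<open>n\<close> is put to the North of its neighbour \<open>c\<close> and on a diagonal through its topmost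
  neighbour \<open>e\<close>.\<close>

lemma extend_above_two:
  assumes IH: "leaf_toppable (V - {n}) \<and> free_toppable (V - {n})"
    and adm: "admissible V S Z" and n: "n \<in> V" and two: "\<And>u. u \<in> V \<Longrightarrow> 2 \<le> deg V u"
    and nb: "nbs V n = {c, e}" "c \<noteq> e" and c: "deg V c = 3"
    and S': "S' \<subseteq> V - {n}" "S' \<subseteq> S \<union> {c}" "labelling S' x'" and Z: "Z \<subseteq> {n}"
    and agree: "\<And>v. v \<in> V - {n} \<Longrightarrow> deg V v \<le> 2 \<Longrightarrow> (v \<in> S' \<longleftrightarrow> v \<in> S) \<and> x' v = x v"
    and lab: "n \<in> S \<Longrightarrow> c \<in> S' \<and> x' c = x n"
    and eS: "deg V e = 2 \<Longrightarrow> e \<in> S"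
    and nocyc: "\<And>K. cyclic_in (V - {n}) K \<Longrightarrow> c \<in> K \<Longrightarrow> \<not> K \<subseteq> S'"
    and free: "c \<notin> S' \<Longrightarrow> \<exists>K. cyclic_in (V - {n}) K \<and> c \<in> K \<and> K - {c} \<subseteq> S'"
    and off: "\<And>K v. cyclic_in V K \<Longrightarrow> v \<in> K \<Longrightarrow> v \<notin> S \<Longrightarrow> K - {v} \<subseteq> S \<Longrightarrow> v \<noteq> n \<Longrightarrow> n \<notin> K"
  shows "\<exists>f. good V S x f \<and> topmost V f n"
proof -
  note a = admissibleD[OF adm]
  have ce: "c \<in> V - {n}" "e \<in> V - {n}" using nb nbs_irrefl[of n V] by (auto simp: nbs_def)
  have drop: "deg V u = Suc (deg (V - {n}) u)" if "u \<in> {c, e}" for u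
    using deg_remove_nb[OF a(1) _ n] nb that by blast
  have dc: "deg (V - {n}) c = 2" using drop[of c] c by simp
  have e23: "deg V e = 2 \<or> deg V e = 3" using a(3)[of e] two[of e] ce by fastforce
  have e_iff: "e \<in> S' \<longleftrightarrow> deg V e = 2"
    using e23 eS agree[OF ce(2)] a(4)[of e] S'(2) nb(2) by fastforce
  have cyc_c: "c \<notin> K" if "cyclic_in V K" for K using that c by (auto simp: cyclic_in_def)
  have nK: "n \<notin> K" if "cyclic_in V K" for K
    using cyc_c[OF that] that nb closed_inD[of V K n c] by (auto simp: cyclic_in_def)
  \<comment> \<open>If \<open>e\<close> had degree 2, it is now a prescribed leaf and
    \<open>leaf_toppable\<close> applies. If it had degree 3, it is now a free vertex of degree 2
    and forms the exception in \<open>free_toppable\<close>.\<close>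
  have adm': "admissible (V - {n}) S' (if deg V e = 2 then {} else {e})"
  proof (rule admissible_remove[OF adm n])
    fix K assume K: "cyclic_in (V - {n}) K" "K \<inter> nbs V n \<noteq> {}"
    show "\<not> K \<subseteq> S'"
    proof (cases "c \<in> K")
      case True then show ?thesis using nocyc K by blast
    next
      case False
      then have "e \<in> K" using K nb by auto
      then show ?thesis using K drop[of e] e_iff by (auto simp: cyclic_in_def)
    qed
  next
    fix v assume "v \<in> nbs V n" "v \<notin> S'" "v \<notin> (if deg V e = 2 then {} else {e})"
    then show "\<exists>K. cyclic_in (V - {n}) K \<and> v \<in> K \<and> K - {v} \<subseteq> S'"
      using free nb e_iff by (auto split: if_splits)
  qed (use S' nb agree Z nK in auto)
  have "\<exists>f. topped (V - {n}) S' x' e f"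
  proof (cases "deg V e = 2")
    case True
    then show ?thesis
      using IH adm' S'(3) e_iff drop[of e] unfolding leaf_toppable_def by auto
  next
    case False
    \<comment> \<open>Both neighbours were cubic, so no leaf arises: the first case of
      \<open>free_toppable\<close>.\<close>
    have "2 \<le> deg (V - {n}) u" if "u \<in> V - {n}" for u
    proof (cases "u \<in> nbs V n")
      case True then show ?thesis using nb drop[of u] c e23 False by auto
    next
      case nu: False
      then show ?thesis using two[of u] deg_remove_nonnb[of u V n] that by simp
    qed
    then show ?thesis
      using IH adm' S'(3) e_iff drop[of e] e23 False ce unfolding free_toppable_def by auto
  qed
  then obtain f where g: "good (V - {n}) S' x' f" and te: "topmost (V - {n}) f e"
    by (auto simp: topped_def)
  have ne: "fst (f c) \<noteq> fst (f e)"
    using good_fst_distinct[OF g ce nb(2)] dc drop[of e] e23 by auto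
  define p where "p = (fst (f c), snd (f e) + \<bar>fst (f c) - fst (f e)\<bar>)"
  note pl = place_above_two[OF g n nb(1) _ te ne p_def]
  have "good V S x (f(n := p))"
  proof (rule good_extend[OF g adm n pl agree])
    show "n \<in> S \<Longrightarrow> fst p = x n" using lab goodD(3)[OF g, of c] by (simp add: p_def)
  next
    fix v assume v: "v \<in> V - {n}" "deg V v \<le> 2"
    then have "v \<noteq> c" using c by auto
    then show "fst p \<noteq> fst (f v)"
      using good_fst_distinct[OF g ce(1) v(1)] dc deg_remove_le[OF a(1), of n v] v by (simp add: p_def)
  next
    fix v assume "v \<in> V - {n}" "deg V v \<le> 1"
    then show "\<not> nw_of p (f v)" using two[of v] by auto
  qed (use dc nK in auto)
  then show ?thesis using pl(2) dc by auto
qed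

text \<open>Without \<open>z\<close> the vertex \<open>c\<close> has degree 2. It stays free if it
  lies on a cycle that is prescribed otherwise; else it receives a fresh label from the infinite set
  \<open>B\<close>.\<close>

lemma free_toppable_cubic:
  assumes IH: "leaf_toppable (V - {z}) \<and> free_toppable (V - {z})"
    and adm: "admissible V S {z}" and lab: "labelling S x" and z: "z \<in> V - S"
    and two: "\<And>u. u \<in> V \<Longrightarrow> 2 \<le> deg V u"
    and nb: "nbs V z = {c, e}" "c \<noteq> e" and c: "deg V c = 3" and eS: "deg V e = 2 \<Longrightarrow> e \<in> S"
  shows "\<exists>f. good V S x f \<and> topmost V f z"
proof (cases "\<exists>K. cyclic_in (V - {z}) K \<and> c \<in> K \<and> K - {c} \<subseteq> S")
  case True
  have cS: "c \<notin> S" using admissibleD(4)[OF adm, of c] c by auto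
  show ?thesis
  proof (rule extend_above_two[OF IH adm _ two nb c _ _ lab])
    show "\<exists>K. cyclic_in (V - {z}) K \<and> c \<in> K \<and> K - {c} \<subseteq> S" by (rule True)
  qed (use z eS cS admissibleD(2)[OF adm] in auto)
next
  case False
  have cS: "c \<notin> S" using admissibleD(4)[OF adm, of c] c by auto
  have cV: "c \<in> V - {z}" using nb nbs_irrefl[of z V] by (auto simp: nbs_def)
  have "finite (x ` S)" using admissibleD(1,2)[OF adm] by (meson finite_imageI finite_subset)
  then obtain \<beta> where \<beta>: "\<beta> \<in> B" "\<beta> \<notin> x ` S" using infinite_B by (metis finite_subset subsetI)
  show ?thesis
  proof (rule extend_above_two[OF IH adm _ two nb c])
    show "labelling (insert c S) (x(c := \<beta>))"
      using lab \<beta> cS by (auto simp: labelling_def inj_on_def)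
    show "\<And>K. cyclic_in (V - {z}) K \<Longrightarrow> c \<in> K \<Longrightarrow> \<not> K \<subseteq> insert c S" using False by blast
  qed (use z eS c cS cV admissibleD(2)[OF adm] in auto)
qed

text \<open>Without \<open>z\<close> both neighbours are leaves, and \<open>e\<close> is made
  topmost. Putting \<open>z\<close> level with \<open>e\<close> and to the Northwest of
  \<open>c\<close> forces its abscissa to be \<open>x c\<close> minus a difference of
  heights.\<close>

lemma free_toppable_join:
  assumes IH: "leaf_toppable (V - {z})"
    and adm: "admissible V S {z}" and lab: "labelling S x" and z: "z \<in> V - S"
    and nb: "nbs V z = {c, e}" "c \<noteq> e" and deg2: "deg V c = 2" "deg V e = 2"
    and S: "c \<in> S" "e \<in> S" and lt: "x c < x e"
  shows "\<exists>f. topped V S x z f"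
proof -
  note a = admissibleD[OF adm]
  have zV: "z \<in> V" using z by simp
  have ce: "c \<in> V - {z}" "e \<in> V - {z}" using nb nbs_irrefl[of z V] by (auto simp: nbs_def)
  have drop: "deg V u = Suc (deg (V - {z}) u)" if "u \<in> {c, e}" for u
    using deg_remove_nb[OF a(1) _ zV] nb that by blast
  have dc: "deg (V - {z}) c = 1" and de: "deg (V - {z}) e = 1" using drop[of c] drop[of e] deg2 by auto
  have nz: "z \<notin> K" if "K - {v} \<subseteq> S" "v \<noteq> z" for K v using that z by auto
  have "admissible (V - {z}) S {}"
  proof (rule admissible_remove[OF adm zV])
    fix K assume "cyclic_in (V - {z}) K" "K \<inter> nbs V z \<noteq> {}"
    then show "\<not> K \<subseteq> S" using nb dc de by (auto simp: cyclic_in_def)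
  qed (use z a(2) S nb nz in auto)
  moreover have "deg (V - {z}) e \<le> 1" using de by simp
  ultimately obtain f where f: "topped (V - {z}) S x e f"
    using IH lab S(2) unfolding leaf_toppable_def by blast
  then have g: "good (V - {z}) S x f" and te: "topmost (V - {z}) f e"
    and off: "\<And>c. c \<in> V - {z} - {e} \<Longrightarrow> deg (V - {z}) c \<le> 1 \<Longrightarrow>
        snd (f e) - snd (f c) - x c \<notin> qspan (B - {x c})"
    by (auto simp: topped_def)
  have rig: "snd (f e) - snd (f w) \<in> qspan (x ` K)"
    if "closed_in (V - {z}) K" "e \<in> K" "K \<subseteq> S" "w \<in> K"
      "\<And>K'. K' \<subseteq> K \<Longrightarrow> closed_in (V - {z}) K' \<Longrightarrow> K' \<noteq> {} \<Longrightarrow> e \<in> K'" for K w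
    using f S(2) that unfolding topped_def by blast
  have fx: "fst (f v) = x v" if "v \<in> S" for v using goodD(3)[OF g that] .
  define p where "p = (fst (f c) - (snd (f e) - snd (f c)), snd (f e))"
  have pl: "drawing V (f(z := p))" "topmost V (f(z := p)) z" "snd (f c) < snd (f e)"
    using place_left_two[OF g zV nb(1) _ te _ p_def] dc lt fx S by auto
  have offc: "snd (f e) - snd (f c) - x c \<notin> qspan (B - {x c})" using off[of c] ce nb(2) dc by auto
  have "good V S x (f(z := p))"
  proof (rule good_extend[OF g adm zV pl(1,2)])
    fix v assume v: "v \<in> V - {z}" "deg V v \<le> 2"
    \<comment> \<open>By the third clause of \<open>topped\<close> at \<open>c\<close>,
      \<open>fst p\<close> is outside the span of the labels other than \<open>x c\<close>, whereas
      all other vertices of degree at most 2 have their abscissae inside.\<close>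
    have px: "snd (f e) - snd (f c) - x c = - fst p" using fx S by (simp add: p_def)
    show "fst p \<noteq> fst (f v)"
    proof (cases "v = c")
      case True then show ?thesis using pl(3) by (simp add: p_def)
    next
      case False
      have "fst (f v) \<in> qspan (B - {x c})"
      proof (cases "v \<in> S")
        case True then show ?thesis using fx label_in_span[OF lab _ S(1), of v] False by simp
      next
        case vS: False
        then obtain K where K: "cyclic_in V K" "v \<in> K" "K - {v} \<subseteq> S" using a(7)[of v] v by auto
        have zK: "z \<notin> K" using nz[OF K(3)] v by auto
        then have cK: "c \<notin> K"
          using closed_inD[of V K c z] K(1) nbs_sym[OF zV, of c] nb by (auto simp: cyclic_in_def)
        then show ?thesis
          using goodD(6)[OF g cyclic_in_remove[OF K(1) zK zV] K(2) vS K(3)] label_span[OF lab K(3) S(1)]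
          by blast
      qed
      then show ?thesis using offc px rat_real.span_neg by metis
    qed
  next
    fix v assume v: "v \<in> V - {z}" "deg V v \<le> 1"
    have vc: "v \<noteq> c" using v deg2 by auto
    have dv: "deg (V - {z}) v \<le> 1" using v deg_remove_le[OF a(1), of z v] by simp
    show "\<not> nw_of p (f v)"
    proof
      \<comment> \<open>\<open>v\<close> would lie on the antidiagonal through \<open>c\<close>, so
        one of these two vertices would already be to the Northwest of the other.\<close>
      assume "nw_of p (f v)"
      then have "fst (f v) + snd (f v) = fst (f c) + snd (f c)" by (auto simp: nw_of_def p_def)
      moreover have "f v \<noteq> f c" using goodD(2)[OF g] v ce vc by (auto dest: inj_onD)
      ultimately have "nw_of (f v) (f c) \<or> nw_of (f c) (f v)" by (auto simp: nw_of_def prod_eq_iff)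
      then show False using goodD(5)[OF g] v ce dv dc by auto
    qed
  next
    fix K assume K: "cyclic_in V K" "z \<in> K" "K - {z} \<subseteq> S"
    have clK: "closed_in V K" using K by (simp add: cyclic_in_def)
    have ceK: "c \<in> K" "e \<in> K" using closed_inD[OF clK K(2)] nb by auto
    \<comment> \<open>\<open>K - {z}\<close> is the path from \<open>c\<close> to \<open>e\<close>,
      whose height differences are combinations of its labels. It is a single component: a closed
      piece with \<open>c\<close> but not \<open>e\<close> is excluded by parity, and one with
      neither would be a fully prescribed cyclic set of \<open>V\<close>.\<close>
    have "snd (f e) - snd (f c) \<in> qspan (x ` (K - {z}))"
    proof (rule rig)
      show "closed_in (V - {z}) (K - {z})" using clK by (auto simp: closed_in_def nbs_remove)
      fix K' assume K': "K' \<subseteq> K - {z}" "closed_in (V - {z}) K'" "K' \<noteq> {}"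
      show "e \<in> K'"
      proof (rule ccontr)
        assume eK': "e \<notin> K'"
        show False
        proof (cases "c \<in> K'")
          case True
          have "deg K' u = 2" if "u \<in> K'" "u \<noteq> c" for u
          proof -
            have "u \<notin> nbs V z" "u \<in> K" using that eK' nb K' by auto
            then show ?thesis
              using closed_in_deg[OF K'(2) that(1)] deg_remove_nonnb[of u V z] K(1)
              by (auto simp: cyclic_in_def closed_in_def)
          qed
          moreover have "deg K' c = 1" using closed_in_deg[OF K'(2) True] dc by simp
          moreover have "finite K'" using K'(2) a(1) by (auto simp: closed_in_def intro: finite_subset)
          ultimately show False using no_single_odd_vertex[OF _ True] by blast
        next
          case False
          then have "closed_in V K'" using closed_in_unremove[OF K'(2) _ zV] nb eK' by auto
          then have "cyclic_in V K'" using K' K(1) by (auto simp: cyclic_in_def)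
          then show False using a(6) K' K(3) by blast
        qed
      qed
    qed (use K ceK ce in auto)
    moreover have "x c \<in> qspan (x ` (K - {z}))" using ceK ce by (intro rat_real.span_base imageI) auto
    ultimately show "fst p \<in> qspan (x ` (K - {z}))"
      using rat_real.span_diff fx S by (auto simp: p_def)
  next
    show "\<And>K v. cyclic_in V K \<Longrightarrow> v \<in> K \<Longrightarrow> v \<notin> S \<Longrightarrow> K - {v} \<subseteq> S \<Longrightarrow> v \<noteq> z \<Longrightarrow> z \<notin> K"
      using nz by blast
  qed (use z in auto)
  \<comment> \<open>\<open>p\<close> is level with \<open>e\<close>, so the clause carries over from
    \<open>e\<close>.\<close>
  moreover have "snd p - snd (f v) - x v \<notin> qspan (B - {x v})" if "v \<in> V - {z}" "deg V v \<le> 1" for v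
    using off[of v] that deg2 deg_remove_le[OF a(1), of z v] by (force simp: p_def)
  ultimately show ?thesis using pl z by (auto simp: topped_def intro!: exI[of _ "f(z := p)"])
qed

section \<open>Case distinctions and the induction\<close>

lemma free_toppable_step:
  assumes IH: "\<And>n. n \<in> V \<Longrightarrow> drawable (V - {n}) \<and> leaf_toppable (V - {n}) \<and> free_toppable (V - {n})"
  shows "free_toppable V"
  unfolding free_toppable_def
proof (intro allI impI)
  fix S x z
  assume adm: "admissible V S {z}" and lab: "labelling S x" and z: "z \<in> V - S" "deg V z = 2"
    and mode: "(\<forall>u\<in>V. 2 \<le> deg V u) \<or> (\<exists>K. cyclic_in V K \<and> z \<in> K \<and> K - {z} \<subseteq> S)"
  note a = admissibleD[OF adm]
  have ih: "leaf_toppable (V - {z}) \<and> free_toppable (V - {z})" using IH z by blast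
  obtain c e where ce: "nbs V z = {c, e}" "c \<noteq> e" using z(2) by (auto simp: deg_def card_2_iff)
  have nbV: "u \<in> V" "u \<noteq> z" if "u \<in> nbs V z" for u
    using that nbs_irrefl[of z V] by (auto simp: nbs_def)
  have deg_nb: "deg V u = 2 \<or> deg V u = 3" if "u \<in> nbs V z" for u
    using mode
  proof
    assume "\<forall>u\<in>V. 2 \<le> deg V u"
    then show ?thesis using nbV[OF that] a(3)[of u] by fastforce
  next
    assume "\<exists>K. cyclic_in V K \<and> z \<in> K \<and> K - {z} \<subseteq> S"
    then show ?thesis using closed_inD[of V _ z u] that by (auto simp: cyclic_in_def)
  qed
  \<comment> \<open>Otherwise \<open>u\<close> and \<open>z\<close> would be two free vertices on
    one cyclic set.\<close>
  have nbS: "u \<in> S" if u: "u \<in> nbs V z" "deg V u = 2" for u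
  proof (rule ccontr)
    assume "u \<notin> S"
    then obtain K where K: "cyclic_in V K" "u \<in> K" "K - {u} \<subseteq> S" using a(7)[of u] u nbV[OF u(1)] by auto
    then have "z \<in> K" using closed_inD[of V K u z] nbs_sym[of z V u] z u by (auto simp: cyclic_in_def)
    then show False using K(3) z nbV[OF u(1)] by auto
  qed
  have cubic: "\<exists>f. topped V S x z f"
    if nb: "nbs V z = {c, e}" "c \<noteq> e" and c: "deg V c = 3" for c e
  proof -
    \<comment> \<open>A cubic neighbour rules out the second case, so there are no leaves; as
      \<open>z\<close> is not prescribed, \<open>good\<close> and \<open>topmost\<close> then give
      \<open>topped\<close>.\<close>
    have two: "\<forall>u\<in>V. 2 \<le> deg V u"
      using mode c nb closed_inD[of V _ z c] by (fastforce simp: cyclic_in_def)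
    then obtain f where "good V S x f" "topmost V f z"
      using free_toppable_cubic[OF ih adm lab z(1) _ nb c] nbS[of e] nb by auto
    then show ?thesis using two z by (fastforce simp: topped_def)
  qed
  show "\<exists>f. topped V S x z f"
  proof (cases "deg V c = 3 \<or> deg V e = 3")
    case True
    then show ?thesis using cubic[OF ce] cubic[of e c] ce by (auto simp: insert_commute)
  next
    case False
    then have d: "deg V c = 2" "deg V e = 2" using deg_nb ce by auto
    have cS: "c \<in> S" "e \<in> S" using nbS d ce by auto
    then have "x c \<noteq> x e" using lab ce by (auto simp: labelling_def inj_on_def)
    then consider "x c < x e" | "x e < x c" by linarith
    then show ?thesis
    proof cases
      case 1 then show ?thesis using free_toppable_join[OF _ adm lab z(1) ce d cS] ih by blast
    next
      case 2
      have "nbs V z = {e, c}" using ce by auto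
      then show ?thesis
        using free_toppable_join[OF _ adm lab z(1) _ _ d(2,1) cS(2,1) 2] ih ce(2) by blast
    qed
  qed
qed

lemma drawable_step:
  assumes IH: "\<And>n. n \<in> V \<Longrightarrow> drawable (V - {n}) \<and> leaf_toppable (V - {n}) \<and> free_toppable (V - {n})"
  shows "drawable V"
  unfolding drawable_def
proof (intro allI impI)
  fix S x assume adm: "admissible V S {}" and lab: "labelling S x"
  note a = admissibleD[OF adm]
  consider "V = {}" | v where "v \<in> V - S" "deg V v \<le> 2" | l where "l \<in> S" "deg V l \<le> 1"
    | "V \<noteq> {}" "\<And>u. u \<in> V \<Longrightarrow> deg V u \<le> 2 \<Longrightarrow> u \<in> S" "\<And>u. u \<in> V \<Longrightarrow> 2 \<le> deg V u"
  proof -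
    have "(\<exists>v\<in>V - S. deg V v \<le> 2) \<or> (\<forall>u\<in>V. deg V u \<le> 2 \<longrightarrow> u \<in> S)" by blast
    moreover have "(\<exists>l\<in>S. deg V l \<le> 1) \<or> (\<forall>u\<in>S. 2 \<le> deg V u)" by force
    ultimately show ?thesis using that by (meson nat_le_linear)
  qed
  then show "\<exists>f. good V S x f"
  proof cases
    case 1
    then have "\<not> (cyclic_in V K \<and> v \<in> K)" for K v by (auto simp: cyclic_in_def closed_in_def)
    then show ?thesis using 1 a(2) by (auto simp: good_def drawing_def)
  next
    case 2
    then obtain K where K: "cyclic_in V K" "v \<in> K" "K - {v} \<subseteq> S" using a(7)[of v] by auto
    then have "deg V v = 2" by (auto simp: cyclic_in_def)
    moreover have "admissible V S {v}" using adm by (auto simp: admissible_def)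
    ultimately show ?thesis
      using free_toppable_step[OF IH] lab 2 K unfolding free_toppable_def topped_def by blast
  next
    case 3
    then show ?thesis
      using leaf_toppable_step[OF IH] lab adm unfolding leaf_toppable_def topped_def by blast
  next
    case 4
    \<comment> \<open>There is neither a leaf nor a free vertex. A prescribed \<open>t\<close> is
      removed, and its cubic neighbour \<open>c\<close> borrows its label, because \<open>t\<close>
      will be put above \<open>c\<close>.\<close>
    obtain t c where t: "t \<in> S" "c \<in> nbs V t" "deg V c = 3"
      "\<And>K. cyclic_in (V - {t}) K \<Longrightarrow> c \<in> K \<Longrightarrow> \<not> K - {c} \<subseteq> S"
      using obtain_removable[OF adm 4(1,3,2)] by blast
    have tV: "t \<in> V" and cV: "c \<in> V" using t a(2) by (auto simp: nbs_def)
    have "deg V t = 2" using a(4)[OF t(1)] 4(3)[OF tV] by simp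
    then have "card (nbs V t - {c}) = 1" using t(2) finite_nbs[OF a(1)] by (simp add: deg_def)
    then obtain e where "nbs V t - {c} = {e}" by (auto simp: card_1_singleton_iff)
    then have e: "nbs V t = {c, e}" "c \<noteq> e" using t(2) by auto
    have eV: "e \<in> V" using e by (auto simp: nbs_def)
    have ct: "c \<noteq> t" using t(2) nbs_irrefl by blast
    have cS: "c \<notin> S" using a(4)[of c] t(3) by auto
    have "\<exists>f. good V S x f \<and> topmost V f t"
    proof (rule extend_above_two[OF _ adm tV 4(3) e t(3)])
      show "leaf_toppable (V - {t}) \<and> free_toppable (V - {t})" using IH tV by blast
      show "labelling (insert c (S - {t})) (x(c := x t))"
        using lab t(1) cS by (auto simp: labelling_def inj_on_def)
      show "\<not> K \<subseteq> insert c (S - {t})" if "cyclic_in (V - {t}) K" "c \<in> K" for K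
        using t(4)[OF that] by blast
      show "t \<notin> K" if "cyclic_in V K" "v \<in> K" "v \<notin> S" for K v
        using that 4(2)[of v] by (auto simp: cyclic_in_def closed_in_def)
    qed (use t ct cV a(2) 4(2)[OF eV] in auto)
    then show ?thesis by blast
  qed
qed

theorem drawable:
  assumes "finite V" shows "drawable V"
proof -
  have "drawable V \<and> leaf_toppable V \<and> free_toppable V"
    using assms
  proof (induction rule: finite_psubset_induct)
    case (psubset V)
    then have IH: "drawable (V - {n}) \<and> leaf_toppable (V - {n}) \<and> free_toppable (V - {n})" if "n \<in> V" for n
      using that by blast
    show ?case using drawable_step[OF IH] leaf_toppable_step[OF IH] free_toppable_step[OF IH] by blast
  qed
  then show ?thesis by blast
qed

section \<open>Two-regular graphs and the main theorem\<close>

text \<open>In a longest path all neighbours of the two ends lie on the path; as interior vertices are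
  already saturated, the ends are adjacent.\<close>

lemma two_regular_connected:
  assumes fin: "finite V" "V \<noteq> {}" and two: "\<And>u. u \<in> V \<Longrightarrow> deg V u = 2"
    and conn: "\<And>K. closed_in V K \<Longrightarrow> K \<noteq> {} \<Longrightarrow> K = V"
  obtains vs where "distinct vs" "3 \<le> length vs" "set vs = V"
    "{(u, w). u \<in> V \<and> w \<in> nbs V u} = (\<Union>i<length vs.
       let a = vs ! i; b = vs ! (Suc i mod length vs) in {(a, b), (b, a)})"
proof -
  define P where "P vs \<longleftrightarrow> distinct vs \<and> vs \<noteq> [] \<and> set vs \<subseteq> V \<and>
    (\<forall>i. Suc i < length vs \<longrightarrow> vs ! Suc i \<in> nbs V (vs ! i))" for vs
  obtain v where "v \<in> V" using fin by blast
  then have single: "P [v]" by (simp add: P_def)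
  have bound: "\<forall>vs. P vs \<longrightarrow> length vs < Suc (card V)"
    using card_mono[OF fin(1)] distinct_card unfolding P_def less_Suc_eq_le by metis
  obtain vs where vs: "P vs" and long: "\<forall>ws. P ws \<longrightarrow> length ws \<le> length vs"
    using ex_has_greatest_nat[OF single bound] by iprover
  define n where "n = length vs"
  have dist: "distinct vs" and sub: "set vs \<subseteq> V" and n0: "n > 0"
    and nxt: "\<And>i. Suc i < n \<Longrightarrow> vs ! Suc i \<in> nbs V (vs ! i)"
    using vs by (auto simp: P_def n_def)
  have inV: "vs ! i \<in> V" if "i < n" for i using sub that by (auto simp: n_def)
  have prev: "vs ! i \<in> nbs V (vs ! Suc i)" if "Suc i < n" for i
    using nbs_sym[OF inV nxt[OF that]] that by simp
  have eq: "vs ! i = vs ! j \<longleftrightarrow> i = j" if "i < n" "j < n" for i j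
    using nth_eq_iff_index_eq[OF dist] that by (simp add: n_def)
  have first: "u \<in> set vs" if u: "u \<in> nbs V (vs ! 0)" for u
  proof (rule ccontr)
    assume nu: "u \<notin> set vs"
    have "vs ! 0 \<in> nbs V u" using nbs_sym[OF inV[OF n0] u] .
    then have "P (u # vs)"
      using vs nu u by (auto simp: P_def nth_Cons nbs_def split: nat.splits)
    then show False using long by fastforce
  qed
  have two_eq: "nbs V u = {a, b}" if "u \<in> V" "a \<in> nbs V u" "b \<in> nbs V u" "a \<noteq> b" for u a b
  proof -
    have "card (nbs V u) = 2" using two[OF that(1)] by (simp add: deg_def)
    moreover have "card {a, b} = 2" using that(4) by simp
    ultimately show ?thesis
      using card_subset_eq[OF finite_nbs[OF fin(1)], of "{a, b}" u] that by simp
  qed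
  have inner: "nbs V (vs ! Suc i) = {vs ! i, vs ! Suc (Suc i)}" if "Suc (Suc i) < n" for i
    using two_eq[OF inV prev nxt] that eq[of i "Suc (Suc i)"] by simp
  \<comment> \<open>The neighbour of the first vertex other than its successor. For a list of length
    1 the term \<open>vs ! 1\<close> is arbitrary, but one of the two neighbours differs from it in
    any case.\<close>
  obtain j where j: "j < n" "vs ! j \<in> nbs V (vs ! 0)" "j \<noteq> 1"
  proof -
    have "card (nbs V (vs ! 0)) = 2" using two[OF inV[OF n0]] by (simp add: deg_def)
    then obtain a b where "nbs V (vs ! 0) = {a, b}" "a \<noteq> b" by (auto simp: card_2_iff)
    then have "\<exists>c \<in> nbs V (vs ! 0). c \<noteq> vs ! 1" by auto
    then obtain c where c: "c \<in> nbs V (vs ! 0)" "c \<noteq> vs ! 1" by blast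
    then obtain j where "j < n" "vs ! j = c" using first by (auto simp: in_set_conv_nth n_def)
    then show ?thesis using c that[of j] by auto
  qed
  have j2: "j \<ge> 2" using j nbs_irrefl[of "vs ! 0" V] by (cases j) auto
  have jn: "Suc j = n"
  proof (rule ccontr)
    assume "Suc j \<noteq> n"
    then have lt: "Suc j < n" using j by simp
    obtain i where i: "j = Suc i" using j2 by (cases j) auto
    have "vs ! 0 \<in> nbs V (vs ! j)" using nbs_sym[OF inV[OF n0] j(2)] .
    then have "vs ! 0 = vs ! i \<or> vs ! 0 = vs ! Suc (Suc i)" using inner[of i] lt i by auto
    then show False using eq[of 0 i] eq[of 0 "Suc (Suc i)"] lt i j2 by auto
  qed
  have n3: "n \<ge> 3" using j2 jn by simp
  have nb0: "nbs V (vs ! 0) = {vs ! 1, vs ! j}"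
    using two_eq[OF inV[OF n0] _ j(2)] nxt[of 0] eq[of 1 j] n3 j by auto
  obtain k where k: "j = Suc k" using j2 by (cases j) auto
  have nbj: "nbs V (vs ! j) = {vs ! k, vs ! 0}"
    using two_eq[of "vs ! j" "vs ! k" "vs ! 0"] inV[OF j(1)] prev[of k]
      nbs_sym[OF inV[OF n0] j(2)] eq[of k 0] k j j2 by auto
  \<comment> \<open>The cyclic predecessor of index 0 is the last index \<open>j\<close>; the
    modulus turns the successor of \<open>j\<close> into 0.\<close>
  have nb: "nbs V (vs ! i) = {vs ! (Suc i mod n), vs ! (if i = 0 then j else i - 1)}" if i: "i < n" for i
  proof -
    consider "i = 0" | "i = j" "i > 0" | i' where "i = Suc i'" "Suc i < n"
      using i jn by (cases i) (auto, metis Suc_lessI)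
    then show ?thesis
    proof cases
      case 1 then show ?thesis using nb0 n3 by simp
    next
      case 2 then show ?thesis using nbj k jn by auto
    next
      case 3 then show ?thesis using inner[of i'] by auto
    qed
  qed
  have "closed_in V (set vs)"
    unfolding closed_in_def
  proof (intro conjI ballI sub)
    fix u assume "u \<in> set vs"
    then obtain i where i: "i < n" "u = vs ! i" by (auto simp: in_set_conv_nth n_def)
    have mem: "vs ! l \<in> set vs" if "l < n" for l using that by (simp add: n_def)
    have "vs ! (Suc i mod n) \<in> set vs" by (rule mem) (use n0 in simp)
    moreover have "vs ! (if i = 0 then j else i - 1) \<in> set vs" by (rule mem) (use i(1) j(1) in auto)
    ultimately show "nbs V u \<subseteq> set vs" unfolding i(2) nb[OF i(1)] by blast
  qed
  then have setV: "set vs = V" using conn n0 by (auto simp: n_def)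
  have "{(u, w). u \<in> V \<and> w \<in> nbs V u} = (\<Union>i<n.
       {(vs ! i, vs ! (Suc i mod n)), (vs ! (Suc i mod n), vs ! i)})" (is "?L = ?R")
  proof
    show "?L \<subseteq> ?R"
    proof clarify
      fix u w assume u: "u \<in> V" "w \<in> nbs V u"
      then obtain i where i: "i < n" "u = vs ! i" using setV by (auto simp: in_set_conv_nth n_def)
      then have "w = vs ! (Suc i mod n) \<or> w = vs ! (if i = 0 then j else i - 1)" using nb u by auto
      moreover define i' where "i' = (if i = 0 then j else i - 1)"
      moreover have i': "i' < n" "Suc i' mod n = i" using i jn by (auto simp: i'_def)
      ultimately consider "w = vs ! (Suc i mod n)" | "w = vs ! i'" by blast
      then show "(u, w) \<in> ?R"
      proof cases
        case 1 then show ?thesis using i by (intro UN_I[of i]) auto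
      next
        case 2 then show ?thesis using i i' by (intro UN_I[of i']) auto
      qed
    qed
    show "?R \<subseteq> ?L"
    proof
      fix q assume "q \<in> ?R"
      then obtain i where i: "i < n"
        "q = (vs ! i, vs ! (Suc i mod n)) \<or> q = (vs ! (Suc i mod n), vs ! i)" by auto
      have "vs ! (Suc i mod n) \<in> nbs V (vs ! i)" using nb[OF i(1)] by simp
      then show "q \<in> ?L" using i(2) inV[OF i(1)] nbs_sym[OF inV[OF i(1)]] by (auto simp: nbs_def)
    qed
  qed
  then show ?thesis using that[of vs] dist n3 setV by (simp add: n_def Let_def)
qed

end

section \<open>Translation of slopes, degrees and connectedness\<close>

lemma has_slope_basic:
  assumes "basic_dir p q" "p \<noteq> q"
  shows "\<exists>\<alpha>\<in>{0, pi / 2, pi / 4, - pi / 4}. has_slope p q \<alpha>"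
proof -
  have m: "cos (- pi / 4) = sqrt 2 / 2" "sin (- pi / 4) = - (sqrt 2 / 2)"
    by (simp_all add: cos_45 sin_45 flip: minus_divide_left)
  consider "fst q = fst p" | "snd q = snd p" | "snd q - snd p = fst q - fst p"
    | "snd q - snd p = - (fst q - fst p)"
    using assms(1) by (auto simp: basic_dir_def abs_eq_iff)
  then show ?thesis
  proof cases
    case 1
    then have "q - p = (snd q - snd p) *\<^sub>R (cos (pi / 2), sin (pi / 2))" by (simp add: prod_eq_iff)
    then show ?thesis using assms(2) by (auto simp: has_slope_def)
  next
    case 2
    then have "q - p = (fst q - fst p) *\<^sub>R (cos 0, sin 0)" by (simp add: prod_eq_iff)
    then show ?thesis using assms(2) unfolding has_slope_def by blast
  next
    case 3
    \<comment> \<open>The factor \<open>sqrt 2\<close> turns the coordinates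
      \<open>sqrt 2 / 2\<close> of the unit vector into 1.\<close>
    then have "q - p = ((fst q - fst p) * sqrt 2) *\<^sub>R (cos (pi / 4), sin (pi / 4))"
      by (simp add: prod_eq_iff cos_45 sin_45 mult.assoc)
    then show ?thesis using assms(2) unfolding has_slope_def by blast
  next
    case 4
    then have "q - p = ((fst q - fst p) * sqrt 2) *\<^sub>R (cos (- pi / 4), sin (- pi / 4))"
      unfolding m by (simp add: prod_eq_iff mult.assoc diff_divide_distrib)
    then show ?thesis using assms(2) unfolding has_slope_def by blast
  qed
qed

lemma northwest_of_imp_nw_of: "northwest_of q p \<Longrightarrow> nw_of q p"
proof -
  assume nw: "northwest_of q p"
  have m: "cos (- pi / 4) = sqrt 2 / 2" "sin (- pi / 4) = - (sqrt 2 / 2)"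
    by (simp_all add: cos_45 sin_45 flip: minus_divide_left)
  obtain t where t: "q - p = t *\<^sub>R (cos (- pi / 4), sin (- pi / 4))" and gt: "snd q > snd p"
    using nw by (auto simp: northwest_of_def has_slope_def)
  have "fst (q - p) + snd (q - p) = 0" unfolding t m by simp
  then show ?thesis using gt by (simp add: nw_of_def)
qed

lemma vdegree_eq_card:
  "vdegree G u = card {w. (u, w) \<in> parcs G}"
proof -
  have "out_arcs (with_proj G) u = Pair u ` {w. (u, w) \<in> parcs G}"
    by (auto simp: out_arcs_def)
  then show ?thesis by (simp add: out_degree_def card_image inj_on_def)
qed

text \<open>Connectedness means strong connectedness of the symmetric closure, which has the same
  arcs because the graph is symmetric. Induction along a walk then stays inside
  \<open>K\<close>.\<close>

lemma connected_closed_eq: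
  assumes "pair_graph G" "Digraph_Component.connected (with_proj G)"
    and K: "K \<subseteq> pverts G" "K \<noteq> {}" "\<And>u w. u \<in> K \<Longrightarrow> (u, w) \<in> parcs G \<Longrightarrow> w \<in> K"
  shows "K = pverts G"
proof -
  interpret pair_graph G by (rule assms)
  let ?H = "with_proj (mk_symmetric (with_proj G))"
  obtain u where u: "u \<in> K" using K by blast
  have arcs: "arcs_ends ?H = parcs G"
    using sym_arcs by (auto simp: mk_symmetric_def symmetric_def dest: symD)
  have "w \<in> K" if "w \<in> pverts G" for w
  proof -
    have "u \<rightarrow>\<^sup>*\<^bsub>?H\<^esub> w"
      using assms(2) u K(1) that
      by (auto simp: Digraph_Component.connected_def strongly_connected_def mk_symmetric_def)
    then have "(u, w) \<in> rtrancl_on (verts ?H) (arcs_ends ?H)" by (simp add: reachable_def)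
    then show ?thesis
    proof (induction rule: rtrancl_on_induct)
      case (step y z) then show ?case using K(3)[of y z] arcs by auto
    qed (rule u)
  qed
  then show ?thesis using K by blast
qed

theorem theorem6p2:
  fixes G :: "'a pair_pre_digraph" and m :: nat
    and v :: "nat \<Rightarrow> 'a" and x :: "nat \<Rightarrow> real"
  assumes "pair_graph G"
    and "Digraph_Component.connected (with_proj G)"
    and "\<not> is_cycle_graph G"
    and "\<forall>u \<in> pverts G. vdegree G u \<le> 3"
    and "\<exists>u \<in> pverts G. vdegree G u < 3"
    and "m \<ge> 1"
    and "bij_betw v {1..m} {u \<in> pverts G. vdegree G u \<le> 2}"
    and "rat_independent_family x {1..m}"
  shows "\<exists>f :: 'a \<Rightarrow> real \<times> real.
           straight_line_drawing G f \<and>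
           (\<forall>i \<in> {1..m}. fst (f (v i)) = x i) \<and>
           (\<forall>(a, b) \<in> parcs G. \<exists>\<alpha> \<in> {0, pi / 2, pi / 4, - pi / 4}. has_slope (f a) (f b) \<alpha>) \<and>
           (\<forall>u \<in> pverts G. vdegree G u = 2 \<longrightarrow>
              (\<forall>w \<in> pverts G. \<not> north_of (f w) (f u))) \<and>
           (\<forall>u \<in> pverts G. vdegree G u = 1 \<longrightarrow>
              (\<forall>w \<in> pverts G. \<not> north_of (f w) (f u) \<and> \<not> northwest_of (f w) (f u)))"
proof -
  interpret pair_graph G by (rule assms(1))
  define E where "E u w \<longleftrightarrow> (u, w) \<in> parcs G" for u w
  define V where "V = pverts G"
  \<comment> \<open>All vertices of degree at most 2 are prescribed, so there is no free vertex at
    the start.\<close>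
  define S where "S = {u \<in> V. vdegree G u \<le> 2}"
  define y where "y = x \<circ> the_inv_into {1..m} v"
  have inj_x: "inj_on x {1..m}" and indep: "rat_real.independent (x ` {1..m})"
    using assms(8) by (auto simp: rat_independent_family_def)
  have bij: "bij_betw v {1..m} S" using assms(7) by (simp add: S_def V_def)
  have y_v: "y (v i) = x i" if "i \<in> {1..m}" for i
    using the_inv_into_f_f[OF bij_betw_imp_inj_on[OF bij] that] by (simp add: y_def)
  have inv_S: "bij_betw (the_inv_into {1..m} v) S {1..m}" by (rule bij_betw_the_inv_into[OF bij])
  obtain B h where B: "x ` {1..m} \<subseteq> B" "infinite B" "\<And>b. b \<in> B \<Longrightarrow> b \<notin> qspan (B - {b})"
    "h > 0" "h \<notin> qspan B"
    using infinite_independent_extension[OF indep] by blast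
  interpret F: slope_frame E B h
  proof
    show "E w u" if "E u w" for u w using that sym_arcs by (auto simp: E_def symmetric_def dest: symD)
    show "\<not> E u u" for u using pair_no_loops[of "(u, u)"] by (auto simp: E_def)
  qed (use B in auto)
  have nbs: "F.nbs V u = {w. (u, w) \<in> parcs G}" for u
    by (auto simp: F.nbs_def E_def V_def dest: in_arcsD2)
  have deg: "F.deg V u = vdegree G u" for u by (simp add: F.deg_def nbs vdegree_eq_card)
  have fin: "finite V" using pair_finite_verts by (simp add: V_def)
  have whole: "K = V" if "F.closed_in V K" "K \<noteq> {}" for K
    using connected_closed_eq[OF assms(1,2), of K, folded V_def] that
    by (auto simp: F.closed_in_def nbs)
  \<comment> \<open>By connectedness a nonempty cyclic set is all of \<open>V\<close>, which makes
    \<open>G\<close> a cycle.\<close>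
  have "\<not> K \<subseteq> S" if K: "F.cyclic_in V K" "K \<noteq> {}" for K
  proof -
    have KV: "K = V" using whole K by (auto simp: F.cyclic_in_def)
    then have "F.deg V u = 2" if "u \<in> V" for u using K that by (auto simp: F.cyclic_in_def)
    then obtain vs where vs: "distinct vs" "3 \<le> length vs" "set vs = V"
      "{(u, w). u \<in> V \<and> w \<in> F.nbs V u} = (\<Union>i<length vs.
         let a = vs ! i; b = vs ! (Suc i mod length vs) in {(a, b), (b, a)})"
      using F.two_regular_connected[OF fin _ _ whole] K KV by blast
    have "{(u, w). u \<in> V \<and> w \<in> F.nbs V u} = parcs G"
      by (auto simp: nbs dest: in_arcsD1[folded V_def])
    then have "is_cycle_graph G"
      unfolding is_cycle_graph_def V_def[symmetric]
      using vs(1-3) vs(4)[symmetric] by (intro exI[of _ vs]) simp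
    then show ?thesis using assms(3) by simp
  qed
  moreover have "\<exists>u\<in>K. F.deg V u \<le> 2" if "F.closed_in V K" "K \<noteq> {}" for K
  proof -
    obtain u where "u \<in> V" "vdegree G u < 3" using assms(5) by (auto simp: V_def)
    then show ?thesis using whole[OF that] deg by (intro bexI[of _ u]) auto
  qed
  moreover have "\<forall>u\<in>V. vdegree G u \<le> 3" using assms(4) by (simp add: V_def)
  ultimately have "F.admissible V S {}"
    using fin by (auto simp: F.admissible_def S_def deg)
  moreover have "F.labelling S y"
    using B(1) inv_S inj_x unfolding F.labelling_def y_def
    by (auto simp: bij_betw_def intro: comp_inj_on)
  ultimately obtain f where f: "F.good V S y f"
    using F.drawable[OF fin] unfolding F.drawable_def by blast
  have inj: "inj_on f V" by (rule F.goodD(2)[OF f])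
  have arcs: "a \<in> V \<and> b \<in> F.nbs V a \<and> a \<noteq> b \<and> b \<in> V" if "(a, b) \<in> parcs G" for a b
    using that pair_no_loops[OF that] in_arcsD1[OF that, folded V_def] in_arcsD2[OF that, folded V_def]
    by (auto simp: nbs)
  have "straight_line_drawing G f"
    using F.goodD(1)[OF f] arcs unfolding straight_line_drawing_def F.drawing_def V_def[symmetric] by blast
  moreover have "fst (f (v i)) = x i" if "i \<in> {1..m}" for i
    using F.goodD(3)[OF f, of "v i"] y_v[OF that] bij_betwE[OF bij] that by simp
  moreover have "\<exists>\<alpha>\<in>{0, pi / 2, pi / 4, - pi / 4}. has_slope (f a) (f b) \<alpha>" if "(a, b) \<in> parcs G" for a b
  proof (rule has_slope_basic)
    show "basic_dir (f a) (f b)" using F.goodD(1)[OF f] arcs[OF that] unfolding F.drawing_def by blast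
    show "f a \<noteq> f b" using inj arcs[OF that] by (auto dest: inj_onD)
  qed
  moreover have "\<not> north_of (f w) (f u)" if "u \<in> V" "vdegree G u \<le> 2" "w \<in> V" for u w
    using F.goodD(4)[OF f] that deg by simp
  moreover have "\<not> northwest_of (f w) (f u)" if "u \<in> V" "vdegree G u \<le> 1" "w \<in> V" for u w
    using F.goodD(5)[OF f that(1,3)] that deg northwest_of_imp_nw_of[of "f w" "f u"] by auto
  ultimately show ?thesis unfolding V_def[symmetric] by (intro exI[of _ f]) auto
qed

end
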